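(* Let $a>0$. For any closed Legendrian $\Lambda\subset\{|z|\le a/2\}\subset(\mathbb{R}^{2n+1},\alpha_{\mathrm{std}})$ and any $\epsilon>0$, there exists a compactly supported contact Hamiltonian of oscillatory norm $a+\epsilon$ that displaces $\Lambda$. In particular, for the standard Legendrian $n$-sphere $\Lambda_{\mathrm{St}}(a)\subset\mathbb{R}^{2n+1}$, the lower bound $a$ on the oscillation of any contact Hamiltonian displacing $\Lambda_{\mathrm{St}}(a)$ is sharp, i.e. $a$ cannot be replaced by any larger constant.
   Context: On $\mathbb{R}^{2n+1}=\{(\mathbf{x},\mathbf{y},z)\}=J^1\mathbb{R}^n$ we use the standard contact form $\alpha_{\mathrm{std}}=dz-\sum y_i\,dx_i$, with Reeb field $\partial_z$. A contact Hamiltonian $H_t$ generates the contact isotopy $\phi^t_{\alpha,H_t}$ determined by $H_t(\phi^t_{\alpha,H_t}(x))=\alpha\left(\frac{d}{dt}\phi^t_{\alpha,H_t}(x)\right)$, and its oscillatory norm is $\|H_t\|_{\mathrm{osc}}=\int_0^1(\max H_t-\min H_t)\,dt$, the extrema being over the ambient space. $H_t$ displaces $\Lambda$ if there are no Reeb chords (integral curves of the Reeb field, in either direction, intersection points counting as chords of length zero) with one endpoint on $\Lambda$ and one on $\phi^1_{\alpha,H_t}(\Lambda)$. The standard Legendrian sphere $\Lambda_{\mathrm{St}}(a)$ is the Legendrian sphere in $\mathbb{R}^{2n+1}$ whose front projection to $\mathbb{R}^{n+1}_{x_1,\ldots,x_n,z}$ is an $O(n)$-symmetric "flying saucer" lying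 in $\{|z|\le a/2\}$ (two graphical sheets over a ball, meeting along a cusp edge over its boundary sphere), and which has exactly one Reeb chord, along the $z$-axis, of length $a$. The displacement-energy estimate obtained from the Legendrian contact DGA says that a contact Hamiltonian displacing $\Lambda_{\mathrm{St}}(a)$ must have oscillation at least $a$. *)

theory Defs
  imports "HOL-Analysis.Analysis"
begin

section \<open>Smooth maps\<close>

text \<open>
  The sets used below are open, or of the form \<open>{0..1} \<times> UNIV\<close>. For such sets the derivative
  within the set is unique, so \<open>smooth_on\<close> means smooth up to the boundary.
\<close>

primrec Ck_on :: "nat \<Rightarrow> 'a::real_normed_vector set \<Rightarrow> ('a \<Rightarrow> 'b::real_normed_vector) \<Rightarrow> bool" where
  "Ck_on 0 S f \<longleftrightarrow> continuous_on S f"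
| "Ck_on (Suc k) S f \<longleftrightarrow>
     f differentiable_on S \<and> (\<forall>v. Ck_on k S (\<lambda>x. frechet_derivative f (at x within S) v))"

definition smooth_on :: "'a::real_normed_vector set \<Rightarrow> ('a \<Rightarrow> 'b::real_normed_vector) \<Rightarrow> bool" where
  "smooth_on S f \<longleftrightarrow> (\<forall>k. Ck_on k S f)"

definition diffeomorphism ::
  "'a::real_normed_vector set \<Rightarrow> 'b::real_normed_vector set \<Rightarrow> ('a \<Rightarrow> 'b) \<Rightarrow> bool" where
  "diffeomorphism U V f \<longleftrightarrow>
     open U \<and> open V \<and> bij_betw f U V \<and> smooth_on U f \<and> smooth_on V (inv_into U f)"


section \<open>The standard contact structure\<close>

text \<open>A point \<open>(x, y, z)\<close> of the 1-jet space of \<open>\<real>\<^sup>n\<close>, where \<open>n = CARD('n) \<ge> 1\<close>.\<close>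

type_synonym 'n jet = "(real ^ 'n) \<times> (real ^ 'n) \<times> real"

definition alpha_std :: "'n::finite jet \<Rightarrow> 'n jet \<Rightarrow> real" where
  "alpha_std = (\<lambda>(x, y, z) (dx, dy, dz). dz - (\<Sum>i\<in>UNIV. y $ i * dx $ i))"

definition reeb_field :: "'n::finite jet \<Rightarrow> 'n jet" where
  "reeb_field p = (0, 0, 1)"

text \<open>
  A chord of length \<open>l\<close> going from \<open>A\<close> to \<open>B\<close>. For \<open>l = 0\<close> the derivative condition is void
  and a chord is a point of \<open>A \<inter> B\<close>.
\<close>

definition reeb_chord ::
  "'n::finite jet set \<Rightarrow> 'n jet set \<Rightarrow> real \<Rightarrow> (real \<Rightarrow> 'n jet) \<Rightarrow> bool" where
  "reeb_chord A B l \<gamma> \<longleftrightarrow>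
     0 \<le> l \<and> \<gamma> 0 \<in> A \<and> \<gamma> l \<in> B \<and>
     (\<forall>t\<in>{0..l}. (\<gamma> has_vector_derivative reeb_field (\<gamma> t)) (at t within {0..l}))"

definition slab :: "real \<Rightarrow> 'n::finite jet set" where
  "slab a = {(x, y, z). \<bar>z\<bar> \<le> a / 2}"


section \<open>Legendrian submanifolds\<close>

text \<open>
  Embedded \<open>n\<close>-dimensional submanifolds without boundary, given by local parametrisations
  \<open>\<psi>\<close>, and everywhere tangent to the kernel of the contact form.
\<close>

definition legendrian :: "'n::finite jet set \<Rightarrow> bool" where
  "legendrian \<Lambda> \<longleftrightarrow>
     (\<forall>p\<in>\<Lambda>. \<exists>U (V :: (real ^ 'n) set) \<psi> \<psi>'.
        open U \<and> p \<in> U \<and> open V \<and> smooth_on V \<psi> \<and> homeomorphism V (\<Lambda> \<inter> U) \<psi> \<psi>' \<and>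
        (\<forall>u\<in>V. inj (frechet_derivative \<psi> (at u)) \<and>
                (\<forall>v. alpha_std (\<psi> u) (frechet_derivative \<psi> (at u) v) = 0)))"

definition closed_legendrian :: "'n::finite jet set \<Rightarrow> bool" where
  "closed_legendrian \<Lambda> \<longleftrightarrow> compact \<Lambda> \<and> legendrian \<Lambda>"


section \<open>Contact Hamiltonians\<close>

definition contactomorphism :: "('n::finite jet \<Rightarrow> 'n jet) \<Rightarrow> bool" where
  "contactomorphism f \<longleftrightarrow>
     diffeomorphism UNIV UNIV f \<and>
     (\<forall>p v. alpha_std (f p) (frechet_derivative f (at p) v) = 0 \<longleftrightarrow> alpha_std p v = 0)"

definition contact_isotopy :: "(real \<Rightarrow> 'n::finite jet \<Rightarrow> 'n jet) \<Rightarrow> bool" where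
  "contact_isotopy \<phi> \<longleftrightarrow>
     smooth_on ({0..1} \<times> UNIV) (\<lambda>(t, p). \<phi> t p) \<and>
     (\<forall>p. \<phi> 0 p = p) \<and>
     (\<forall>t\<in>{0..1}. contactomorphism (\<phi> t))"

definition contact_hamiltonian :: "(real \<Rightarrow> 'n::finite jet \<Rightarrow> real) \<Rightarrow> bool" where
  "contact_hamiltonian H \<longleftrightarrow> smooth_on ({0..1} \<times> UNIV) (\<lambda>(t, p). H t p)"

definition compactly_supported :: "(real \<Rightarrow> 'n::finite jet \<Rightarrow> real) \<Rightarrow> bool" where
  "compactly_supported H \<longleftrightarrow> (\<exists>K. compact K \<and> (\<forall>t\<in>{0..1}. \<forall>p. p \<notin> K \<longrightarrow> H t p = 0))"

definition generates ::
  "(real \<Rightarrow> 'n::finite jet \<Rightarrow> real) \<Rightarrow> (real \<Rightarrow> 'n jet \<Rightarrow> 'n jet) \<Rightarrow> bool" where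
  "generates H \<phi> \<longleftrightarrow>
     contact_isotopy \<phi> \<and>
     (\<forall>t\<in>{0..1}. \<forall>p.
        H t (\<phi> t p) =
          alpha_std (\<phi> t p) (vector_derivative (\<lambda>s. \<phi> s p) (at t within {0..1})))"

text \<open>
  For compactly supported \<open>H\<close> the supremum and infimum are attained and the integrand is continuous;
  the definition is used only for such \<open>H\<close>.
\<close>

definition osc_norm :: "(real \<Rightarrow> 'n::finite jet \<Rightarrow> real) \<Rightarrow> real" where
  "osc_norm H = integral {0..1} (\<lambda>t. (SUP p. H t p) - (INF p. H t p))"

definition displaces :: "(real \<Rightarrow> 'n::finite jet \<Rightarrow> real) \<Rightarrow> 'n jet set \<Rightarrow> bool" where
  "displaces H \<Lambda> \<longleftrightarrow>
     contact_hamiltonian H \<and>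
     (\<exists>\<phi>. generates H \<phi> \<and>
          \<not> (\<exists>l \<gamma>. reeb_chord \<Lambda> (\<phi> 1 ` \<Lambda>) l \<gamma> \<or> reeb_chord (\<phi> 1 ` \<Lambda>) \<Lambda> l \<gamma>))"


section \<open>The standard Legendrian sphere\<close>

text \<open>
  A smooth map on the unit sphere is one that extends smoothly to a neighbourhood of it; the tangent
  space of the sphere at \<open>u\<close> is the orthogonal complement of \<open>u\<close>.
\<close>

definition legendrian_sphere :: "'n::finite jet set \<Rightarrow> bool" where
  "legendrian_sphere \<Lambda> \<longleftrightarrow>
     closed_legendrian \<Lambda> \<and>
     (\<exists>W F. open W \<and> sphere (0 :: (real ^ 'n) \<times> real) 1 \<subseteq> W \<and> smooth_on W F \<and>
        bij_betw F (sphere 0 1) \<Lambda> \<and>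
        (\<forall>u\<in>sphere 0 1. \<forall>v. u \<bullet> v = 0 \<longrightarrow> frechet_derivative F (at u) v = 0 \<longrightarrow> v = 0))"

definition front :: "'n::finite jet \<Rightarrow> (real ^ 'n) \<times> real" where
  "front = (\<lambda>(x, y, z). (x, z))"

text \<open>
  Near a cusp edge point the set \<open>S\<close> is diffeomorphic to the product of the semicubical cusp
  \<open>z\<^sup>2 = s\<^sup>3\<close>, with \<open>s\<close> the coordinate in a unit direction \<open>e\<close>, and the orthogonal complement of \<open>e\<close>
  in \<open>\<real>\<^sup>n\<close>.
\<close>

definition cusp_edge_point :: "((real ^ 'n::finite) \<times> real) set \<Rightarrow> (real ^ 'n) \<times> real \<Rightarrow> bool" where
  "cusp_edge_point S q \<longleftrightarrow>
     (\<exists>U (V :: ((real ^ 'n) \<times> real) set) G e.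
        q \<in> U \<and> diffeomorphism U V G \<and> G q = 0 \<and> norm e = 1 \<and>
        G ` (S \<inter> U) = {(v, z). z\<^sup>2 = (v \<bullet> e) ^ 3} \<inter> V)"

definition flying_saucer :: "((real ^ 'n::finite) \<times> real) set \<Rightarrow> bool" where
  "flying_saucer S \<longleftrightarrow>
     (\<forall>A. orthogonal_transformation A \<longrightarrow> (\<lambda>(x, z). (A x, z)) ` S = S) \<and>
     (\<exists>r f g. 0 < r \<and>
        S = (\<lambda>x. (x, f x)) ` cball 0 r \<union> (\<lambda>x. (x, g x)) ` cball 0 r \<and>
        continuous_on (cball 0 r) f \<and> continuous_on (cball 0 r) g \<and>
        smooth_on (ball 0 r) f \<and> smooth_on (ball 0 r) g \<and>
        (\<forall>x\<in>ball 0 r. f x < g x) \<and>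
        (\<forall>x\<in>sphere 0 r. f x = g x \<and> cusp_edge_point S (x, f x)))"

text \<open>
  The shape of the saucer is only fixed up to the choice of its profile, so this is a predicate. An
  instance is the image of the unit sphere in \<open>\<real>\<^sup>n \<times> \<real>\<close> under
  \<open>(u, w) \<mapsto> (u, - (3 * a / 2) * w * u, (a / 2) * w ^ 3)\<close>.
\<close>

definition standard_legendrian_sphere :: "real \<Rightarrow> 'n::finite jet set \<Rightarrow> bool" where
  "standard_legendrian_sphere a \<Lambda> \<longleftrightarrow>
     legendrian_sphere \<Lambda> \<and> \<Lambda> \<subseteq> slab a \<and> flying_saucer (front ` \<Lambda>) \<and>
     (\<exists>\<gamma>. reeb_chord \<Lambda> \<Lambda> a \<gamma> \<and> (\<forall>t\<in>{0..a}. \<exists>z. \<gamma> t = (0, 0, z)) \<and>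
          (\<forall>l \<gamma>'. 0 < l \<and> reeb_chord \<Lambda> \<Lambda> l \<gamma>' \<longrightarrow> l = a \<and> (\<forall>t\<in>{0..a}. \<gamma>' t = \<gamma> t)))"

end

(*
  The Hamiltonian -b z shrinks y and z exponentially, and its oscillation over the shrinking slab
  integrates to a (1 - exp (- b)).  Adding -c (y . e) with |e| = 1 translates x with speed c at the
  same time; since y shrinks like exp (- b t), this costs only O(c / b).  Once c exceeds the diameter
  of the x-projection of Lambda, the final position has disjoint x-projection, so there are no chords.

  The cutoff is arranged so that nothing has to be estimated along the flow.  In the coordinates
  (x, exp (b t) y, exp (b t) z) the motion is the autonomous contact flow of F = b z + G, where the
  compactly supported G equals -b z - c (y . e) near the trajectories of Lambda and has extrema N
  and -N.  There the field of F is the constant (c e, 0, 0).  In the original coordinates the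
  Hamiltonian is exp (- b t) G, of oscillation exactly 2 N exp (- b t), and N is tuned so that the
  integral is a + epsilon.
*)
theory Submission imports Defs begin

section \<open>Calculus of k times differentiable maps\<close>

text \<open>Along the trajectories of \<open>\<Lambda>\<close> the Hamiltonian
  \<open>- b z - c (y . e)\<close> is bounded in the stretched coordinates by
  \<open>M = b a / 2 + c R\<close>, so it costs at least \<open>2 M (1 - exp (- b)) / b\<close>,
  which is at most \<open>a + 2 c R / b\<close>. With \<open>c\<close> fixed by the size of
  \<open>\<Lambda>\<close>, a large \<open>b\<close> makes the excess smaller than
  \<open>\<epsilon>\<close>. Hence \<open>M < N\<close>, and this gap is the room for the
  truncation. As the norm has to be \<open>a + \<epsilon>\<close> exactly, the truncation is built
  to attain \<open>N\<close> and \<open>- N\<close>.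

  The main obstacle is to exhibit a smooth isotopy through contactomorphisms. Besides removing the
  time dependence, the stretched coordinates give a field that is linear plus compactly supported,
  hence globally Lipschitz: solutions exist for all times and the group law inverts the flow. Smooth
  dependence on initial values is therefore proved for globally Lipschitz fields on the whole space,
  and smoothness on \<open>{0..1} \<times> UNIV\<close> follows by restriction.\<close>

lemma Ck_on_cong:
  assumes "\<And>x. x \<in> S \<Longrightarrow> f x = g x"
  shows "Ck_on k S f \<longleftrightarrow> Ck_on k S g"
  using assms
proof (induction k arbitrary: f g)
  case 0
  then show ?case using continuous_on_cong by force
next
  case (Suc k)
  have d: "(f has_derivative D) (at x within S) \<longleftrightarrow> (g has_derivative D) (at x within S)"
    if "x \<in> S" for D x
    using that Suc.prems by (metis has_derivative_transform)
  have "frechet_derivative f (at x within S) = frechet_derivative g (at x within S)" if "x \<in> S" for x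
    unfolding frechet_derivative_def using d that by presburger
  moreover have "f differentiable_on S \<longleftrightarrow> g differentiable_on S"
    unfolding differentiable_on_def differentiable_def using d by blast
  ultimately show ?case
    by (metis (no_types, lifting) Ck_on.simps(2) Suc.IH)
qed

lemma Ck_on_continuous_on: "Ck_on k S f \<Longrightarrow> continuous_on S f"
  by (cases k) (auto simp: differentiable_imp_continuous_on)

lemma Ck_on_SucD: "Ck_on (Suc k) S f \<Longrightarrow> Ck_on k S f"
proof (induction k arbitrary: f)
  case 0
  then show ?case by (auto simp: differentiable_imp_continuous_on)
next
  case (Suc k)
  then show ?case by (metis Ck_on.simps(2))
qed

text \<open>On \<open>UNIV\<close> derivatives are unique, so a derivative found by the usual rules
  may stand in for \<open>frechet_derivative\<close>. All smoothness proofs below run on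
  \<open>UNIV\<close> for this reason.\<close>

lemma Ck_SucI:
  assumes "\<And>x. (f has_derivative f' x) (at x)" "\<And>v. Ck_on k UNIV (\<lambda>x. f' x v)"
  shows "Ck_on (Suc k) UNIV f"
proof -
  have "frechet_derivative f (at x) = f' x" for x
    using assms(1) frechet_derivative_at by metis
  then show ?thesis
    using assms by (auto simp: differentiable_on_def differentiable_def)
qed

lemma Ck_SucD:
  assumes "Ck_on (Suc k) UNIV f"
  shows "(f has_derivative frechet_derivative f (at x)) (at x)"
    and "Ck_on k UNIV (\<lambda>x. frechet_derivative f (at x) v)"
  using assms by (auto simp: differentiable_on_def frechet_derivative_works[symmetric])

lemma Ck_const: "Ck_on k UNIV (\<lambda>x. c)"
proof (induction k arbitrary: c)
  case (Suc k)
  show ?case by (rule Ck_SucI[OF has_derivative_const]) (rule Suc.IH)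
qed auto

lemma Ck_linear:
  assumes "bounded_linear f"
  shows "Ck_on k UNIV f"
proof (cases k)
  case 0
  then show ?thesis using assms by (simp add: linear_continuous_on)
next
  case (Suc m)
  show ?thesis unfolding Suc
    by (rule Ck_SucI[OF bounded_linear_imp_has_derivative[OF assms]]) (rule Ck_const)
qed

lemma Ck_linear_compose:
  assumes "bounded_linear h" "Ck_on k UNIV f"
  shows "Ck_on k UNIV (\<lambda>x. h (f x))"
  using assms(2)
proof (induction k arbitrary: f)
  case 0
  then show ?case
    using bounded_linear.continuous_on[OF assms(1)] by auto
next
  case (Suc k)
  show ?case
    by (rule Ck_SucI[OF bounded_linear.has_derivative[OF assms(1) Ck_SucD(1)[OF Suc.prems]]])
       (rule Suc.IH[OF Ck_SucD(2)[OF Suc.prems]])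
qed

lemma Ck_add:
  assumes "Ck_on k UNIV f" "Ck_on k UNIV g"
  shows "Ck_on k UNIV (\<lambda>x. f x + g x)"
  using assms
proof (induction k arbitrary: f g)
  case 0
  then show ?case by (auto intro: continuous_intros)
next
  case (Suc k)
  show ?case
    by (rule Ck_SucI[OF has_derivative_add[OF Ck_SucD(1)[OF Suc.prems(1)] Ck_SucD(1)[OF Suc.prems(2)]]])
       (rule Suc.IH[OF Ck_SucD(2)[OF Suc.prems(1)] Ck_SucD(2)[OF Suc.prems(2)]])
qed

lemma Ck_bilinear:
  assumes "bounded_bilinear h" "Ck_on k UNIV f" "Ck_on k UNIV g"
  shows "Ck_on k UNIV (\<lambda>x. h (f x) (g x))"
  using assms(2,3)
proof (induction k arbitrary: f g)
  case 0
  then show ?case using bounded_bilinear.continuous_on[OF assms(1)] by auto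
next
  case (Suc k)
  note D = Ck_SucD[OF Suc.prems(1)] Ck_SucD[OF Suc.prems(2)]
  \<comment> \<open>The product rule leaves one factor undifferentiated in each term; these factors
    are lowered to order \<open>k\<close> to meet the induction hypothesis.\<close>
  note M = Suc.prems[THEN Ck_on_SucD]
  show ?case
    by (rule Ck_SucI[OF bounded_bilinear.FDERIV[OF assms(1) D(1) D(3)]])
       (intro Ck_add Suc.IH D M)
qed

lemmas Ck_mult = Ck_bilinear[OF bounded_bilinear_mult]
  and Ck_scaleR = Ck_bilinear[OF bounded_bilinear_scaleR]
  and Ck_inner = Ck_bilinear[OF bounded_bilinear_inner]
  and Ck_uminus = Ck_linear_compose[OF bounded_linear_minus[OF bounded_linear_ident]]
  and Ck_fst = Ck_linear_compose[OF bounded_linear_fst]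
  and Ck_snd = Ck_linear_compose[OF bounded_linear_snd]
  and Ck_ident = Ck_linear[OF bounded_linear_ident]

lemma Ck_diff:
  "Ck_on k UNIV f \<Longrightarrow> Ck_on k UNIV g \<Longrightarrow> Ck_on k UNIV (\<lambda>x. f x - g x)"
  using Ck_add[of k f "\<lambda>x. - g x"] Ck_uminus[of k g] by simp

lemma Ck_Pair:
  assumes "Ck_on k UNIV f" "Ck_on k UNIV g"
  shows "Ck_on k UNIV (\<lambda>x. (f x, g x))"
proof -
  have l: "bounded_linear (\<lambda>a::'b. (a, 0::'c))" "bounded_linear (\<lambda>a::'c. (0::'b, a))"
    by (auto intro!: bounded_linear_Pair bounded_linear_ident bounded_linear_zero)
  show ?thesis
    using Ck_add[OF Ck_linear_compose[OF l(1) assms(1)] Ck_linear_compose[OF l(2) assms(2)]] by simp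
qed

lemma Ck_sum:
  assumes "\<And>i. i \<in> I \<Longrightarrow> Ck_on k UNIV (f i)"
  shows "Ck_on k UNIV (\<lambda>x. \<Sum>i\<in>I. f i x)"
  using assms by (induction I rule: infinite_finite_induct) (auto simp: Ck_const intro: Ck_add)

text \<open>\<open>Ck_on\<close> differentiates in fixed directions only. Where a derivative meets a
  vector that itself varies, as in the chain rule, this expansion reduces it to finitely many fixed
  directions with scalar coefficients.\<close>

lemma linear_euclidean_sum:
  fixes f :: "'a::euclidean_space \<Rightarrow> 'b::real_normed_vector"
  assumes "linear f"
  shows "f v = (\<Sum>i\<in>Basis. (v \<bullet> i) *\<^sub>R f i)"
proof -
  have "f v = f (\<Sum>i\<in>Basis. (v \<bullet> i) *\<^sub>R i)" by (simp add: euclidean_representation)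
  also have "\<dots> = (\<Sum>i\<in>Basis. (v \<bullet> i) *\<^sub>R f i)"
    using assms by (simp add: linear_sum linear_scale)
  finally show ?thesis .
qed

lemma Ck_compose:
  fixes f :: "'a::euclidean_space \<Rightarrow> 'b::real_normed_vector"
  assumes "Ck_on k UNIV f" "Ck_on k UNIV g"
  shows "Ck_on k UNIV (\<lambda>x. f (g x))"
  using assms
proof (induction k arbitrary: f)
  case 0
  then show ?case by (auto intro: continuous_on_compose2)
next
  case (Suc k)
  note Df = Ck_SucD[OF Suc.prems(1)] and Dg = Ck_SucD[OF Suc.prems(2)]
  have 1: "((\<lambda>x. f (g x)) has_derivative
      (\<lambda>v. \<Sum>i\<in>Basis. (frechet_derivative g (at x) v \<bullet> i) *\<^sub>R frechet_derivative f (at (g x)) i)) (at x)" for x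
    using has_derivative_compose[OF Dg(1) Df(1)]
      linear_euclidean_sum[OF has_derivative_linear[OF Df(1)]] by (metis (no_types, lifting) ext)
  have M: "Ck_on k UNIV g" using Suc.prems(2) by (rule Ck_on_SucD)
  show ?case
    by (rule Ck_SucI[OF 1]) (intro Ck_sum Ck_scaleR Ck_inner Dg Ck_const Suc.IH[OF Df(2) M])
qed

text \<open>Inside \<open>S\<close>, \<open>frechet_derivative\<close> is a choice among possible
  derivatives. Arbitrarily small nonzero steps within \<open>S\<close> along each basis vector make
  it unique, so it agrees with the derivative on the whole space.\<close>

lemma Ck_on_UNIV_imp:
  fixes f :: "'a::euclidean_space \<Rightarrow> 'b::real_normed_vector"
  assumes S: "\<And>x i e. x \<in> S \<Longrightarrow> i \<in> Basis \<Longrightarrow> 0 < e \<Longrightarrow> \<exists>d. 0 < \<bar>d\<bar> \<and> \<bar>d\<bar> < e \<and> x + d *\<^sub>R i \<in> S"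
    and f: "Ck_on k UNIV f"
  shows "Ck_on k S f"
  using f
proof (induction k arbitrary: f)
  case 0
  then show ?case using continuous_on_subset by auto
next
  case (Suc k)
  note D = Ck_SucD[OF Suc.prems]
  have d: "(f has_derivative frechet_derivative f (at x)) (at x within S)" for x
    using D(1) has_derivative_at_withinI by blast
  then have diff: "f differentiable_on S" by (auto simp: differentiable_on_def differentiable_def)
  have "frechet_derivative f (at x within S) = frechet_derivative f (at x)" if "x \<in> S" for x
    using d diff that S
    by (intro frechet_derivative_unique_within[OF _ d])
       (auto simp: differentiable_on_def frechet_derivative_works[symmetric])
  then have "Ck_on k S (\<lambda>x. frechet_derivative f (at x within S) v)" for v
    using Suc.IH[OF D(2)] Ck_on_cong[of S] by (metis (no_types, lifting))
  then show ?case using diff by simp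
qed

lemma smooth_on_unit_time:
  fixes f :: "real \<times> 'a::euclidean_space \<Rightarrow> 'b::real_normed_vector"
  assumes "\<And>k. Ck_on k UNIV f"
  shows "smooth_on ({0..1} \<times> UNIV) f"
  unfolding smooth_on_def
proof (rule allI, rule Ck_on_UNIV_imp[OF _ assms])
  fix x i :: "real \<times> 'a" and e :: real
  assume x: "x \<in> {0..1} \<times> (UNIV :: 'a set)" and i: "i \<in> Basis" and e: "0 < e"
  obtain t :: real and p where tp: "x = (t, p)" "0 \<le> t" "t \<le> 1" using x by (cases x) auto
  \<comment> \<open>The step points away from the nearer end of the time interval and has length at
    most 1/2, so the time coordinate stays in \<open>{0..1}\<close>.\<close>
  define d where "d = (if t < 1/2 then min e 1 / 2 else - min e 1 / 2)"
  have d: "0 < \<bar>d\<bar> \<and> \<bar>d\<bar> < e" using e by (auto simp: d_def)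
  have "0 \<le> t + d" "t + d \<le> 1" "0 \<le> t" "t \<le> 1" using tp e by (auto simp: d_def min_def)
  then show "\<exists>d. 0 < \<bar>d\<bar> \<and> \<bar>d\<bar> < e \<and> x + d *\<^sub>R i \<in> {0..1} \<times> UNIV"
    using d i tp by (intro exI[of _ d]) (auto simp: Basis_prod_def)
qed

section \<open>A smooth cutoff function\<close>

text \<open>The powers \<open>inverse x ^ m\<close> make the family closed under differentiation up
  to linear combinations, so one induction over all \<open>m\<close> gives smoothness. The case
  \<open>m = 0\<close> is the classical flat function.\<close>

definition flat_exp :: "nat \<Rightarrow> real \<Rightarrow> real" where
  "flat_exp m x = (if x \<le> 0 then 0 else inverse x ^ m * exp (- inverse x))"

lemma flat_exp_tendsto_0: "(flat_exp m \<longlongrightarrow> 0) (at 0)"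
proof -
  have "((\<lambda>x::real. inverse x ^ m * exp (- inverse x)) \<longlongrightarrow> 0) (at_right 0)"
  proof -
    have "((\<lambda>y::real. y ^ m / exp y) \<longlongrightarrow> 0) at_top" by (rule tendsto_power_div_exp_0)
    then have "((\<lambda>x::real. inverse x ^ m / exp (inverse x)) \<longlongrightarrow> 0) (at_right 0)"
      by (rule filterlim_compose[OF _ filterlim_inverse_at_top_right])
    then show ?thesis by (simp add: exp_minus field_simps)
  qed
  then have r: "(flat_exp m \<longlongrightarrow> 0) (at_right 0)"
    by (rule Lim_transform_eventually)
       (auto simp: eventually_at_right_field flat_exp_def intro!: exI[of _ 1])
  have "((\<lambda>x. 0) \<longlongrightarrow> 0) (at_left (0::real))" by simp
  then have l: "(flat_exp m \<longlongrightarrow> 0) (at_left 0)"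
    by (rule Lim_transform_eventually)
       (auto simp: eventually_at_left_field flat_exp_def intro!: exI[of _ "-1"])
  show ?thesis using l r filterlim_at_split by blast
qed

lemma flat_exp_DERIV:
  "(flat_exp m has_real_derivative (flat_exp (m+2) x - real m * flat_exp (m+1) x)) (at x)"
proof -
  consider "x < 0" | "x = 0" | "x > 0" by linarith
  then show ?thesis
  proof cases
    case 1
    have "((\<lambda>x. 0) has_real_derivative (flat_exp (m+2) x - real m * flat_exp (m+1) x)) (at x)"
      using 1 by (simp add: flat_exp_def)
    then show ?thesis
      by (rule has_field_derivative_transform_within_open[where S = "{..<0}"])
         (use 1 in \<open>auto simp: flat_exp_def\<close>)
  next
    \<comment> \<open>The difference quotient of \<open>flat_exp m\<close> at 0 is
      \<open>flat_exp (Suc m)\<close>, whose limit at 0 is known.\<close>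
    case 2
    have "\<forall>\<^sub>F h in at 0. flat_exp (Suc m) h = (flat_exp m (0 + h) - flat_exp m 0) / h"
      by (auto simp: eventually_at flat_exp_def field_simps intro!: exI[of _ 1])
    then have "((\<lambda>h. (flat_exp m (0 + h) - flat_exp m 0) / h) \<longlongrightarrow> 0) (at 0)"
      using flat_exp_tendsto_0[of "Suc m"] by (rule Lim_transform_eventually[rotated])
    then show ?thesis using 2 by (simp add: DERIV_def flat_exp_def)
  next
    case 3
    have "((\<lambda>x. inverse x ^ m * exp (- inverse x)) has_real_derivative
        (flat_exp (m+2) x - real m * flat_exp (m+1) x)) (at x)"
    proof -
      \<comment> \<open>For \<open>m = 0\<close> the truncated exponent \<open>m - 1\<close> is
        harmless because of the factor \<open>real m\<close>.\<close>
      have p: "real m * inverse x ^ (m - 1) = real m * inverse x ^ m * x"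
        using 3 by (cases m) auto
      have "((\<lambda>x. inverse x ^ m * exp (- inverse x)) has_real_derivative
          real m * inverse x ^ (m - 1) * - (inverse x * inverse x) * exp (- inverse x)
          + inverse x ^ m * (exp (- inverse x) * (inverse x * inverse x))) (at x)"
        using 3 by (auto intro!: derivative_eq_intros)
      then show ?thesis unfolding p using 3 by (simp add: flat_exp_def field_simps)
    qed
    then show ?thesis
      by (rule has_field_derivative_transform_within_open[where S = "{0<..}"])
         (use 3 in \<open>auto simp: flat_exp_def\<close>)
  qed
qed

lemma Ck_flat_exp: "Ck_on k UNIV (flat_exp m)"
proof (induction k arbitrary: m)
  case 0
  show ?case using DERIV_isCont[OF flat_exp_DERIV] by (auto simp: continuous_on_eq_continuous_at)
next
  case (Suc k)
  show ?case
    by (rule Ck_SucI[OF flat_exp_DERIV[unfolded has_field_derivative_def]])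
       (intro Ck_mult Ck_diff Ck_const Suc.IH)
qed

text \<open>
  Composing the flat function with itself makes the cutoff equal to 1 for \<open>x \<le> 0\<close> and to 0 for
  \<open>x \<ge> 1\<close> without dividing by a smooth function.
\<close>

definition cutoff :: "real \<Rightarrow> real" where
  "cutoff x = exp 1 * flat_exp 0 (1 - exp 1 * flat_exp 0 x)"

lemma Ck_cutoff: "Ck_on k UNIV cutoff"
  unfolding cutoff_def
  by (intro Ck_mult Ck_compose[OF Ck_flat_exp] Ck_diff Ck_const Ck_flat_exp)

lemma exp_flat_exp_ge_1: "x \<ge> 1 \<Longrightarrow> exp 1 * flat_exp 0 x \<ge> 1"
  by (auto simp: flat_exp_def exp_add[symmetric] field_simps)

lemma flat_exp_nonneg: "0 \<le> flat_exp m x"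
  by (auto simp: flat_exp_def)

lemma cutoff_eq_1: "x \<le> 0 \<Longrightarrow> cutoff x = 1"
  by (auto simp: cutoff_def flat_exp_def exp_add[symmetric])

lemma cutoff_eq_0: "x \<ge> 1 \<Longrightarrow> cutoff x = 0"
  using exp_flat_exp_ge_1[of x] by (simp add: cutoff_def flat_exp_def)

lemma cutoff_nonneg: "0 \<le> cutoff x"
  by (simp add: cutoff_def flat_exp_nonneg)

lemma cutoff_le_1: "cutoff x \<le> 1"
proof -
  define y where "y = 1 - exp 1 * flat_exp 0 x"
  have "y \<le> 1" by (simp add: y_def flat_exp_nonneg)
  then have "exp 1 * flat_exp 0 y \<le> 1"
    by (auto simp: flat_exp_def exp_add[symmetric] field_simps)
  then show ?thesis by (simp add: cutoff_def y_def)
qed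

section \<open>Ordinary differential equations\<close>

lemma gronwall_nonneg:
  fixes w :: "real \<Rightarrow> 'a::real_inner"
  assumes t: "0 \<le> t"
    and w: "\<And>s. 0 \<le> s \<Longrightarrow> s \<le> t \<Longrightarrow> (w has_vector_derivative w' s) (at s)"
    and b: "\<And>s. 0 \<le> s \<Longrightarrow> s \<le> t \<Longrightarrow> norm (w' s) \<le> L * norm (w s) + e"
    and L: "0 \<le> L" and e: "0 \<le> e"
  shows "norm (w t) \<le> (norm (w 0) + e * t) * exp (L * t)"
proof -
  have "norm (w t) \<le> (norm (w 0) + d + e * t) * exp (L * t)" if d: "d > 0" for d
  proof -
    \<comment> \<open>The norm is not differentiable at 0; adding \<open>d\<^sup>2\<close> under the
      root repairs this, and \<open>d\<close> tends to 0 at the end.\<close>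
    define g where "g s = sqrt (w s \<bullet> w s + d\<^sup>2)" for s
    have pos: "w s \<bullet> w s + d\<^sup>2 > 0" for s
      using d by (simp add: add_nonneg_pos)
    have gpos: "g s > 0" for s using pos by (simp add: g_def)
    have wg: "norm (w s) \<le> g s" for s
      by (simp add: g_def norm_eq_sqrt_inner)
    \<comment> \<open>The integrating factor absorbs the term with \<open>L\<close>. Since
      \<open>exp (- L * s) \<le> 1\<close>, subtracting \<open>e * s\<close> is enough to absorb the
      rest and make \<open>h\<close> nonincreasing.\<close>
    define h where "h s = exp (- L * s) * g s - e * s" for s
    have "h t \<le> h 0"
    proof (rule DERIV_nonpos_imp_nonincreasing[OF t])
      fix s assume s: "0 \<le> s" "s \<le> t"
      have "((\<lambda>s. w s \<bullet> w s) has_real_derivative 2 * (w s \<bullet> w' s)) (at s)"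
        using has_derivative_inner[OF w[OF s, unfolded has_vector_derivative_def] w[OF s, unfolded has_vector_derivative_def]]
        unfolding has_field_derivative_def
        by (rule has_derivative_eq_rhs) (auto simp: fun_eq_iff inner_commute algebra_simps)
      then have "((\<lambda>s. w s \<bullet> w s + d\<^sup>2) has_real_derivative 2 * (w s \<bullet> w' s)) (at s)"
        by (auto intro!: derivative_eq_intros)
      then have "(g has_real_derivative (inverse (g s) / 2) * (2 * (w s \<bullet> w' s))) (at s)"
        unfolding g_def by (rule DERIV_chain2[where f = sqrt and g = "\<lambda>s. w s \<bullet> w s + d\<^sup>2", OF DERIV_real_sqrt[OF pos]])
      then have gd: "(g has_real_derivative (w s \<bullet> w' s) / g s) (at s)"
        by (simp add: field_simps)
      have "w s \<bullet> w' s \<le> norm (w s) * norm (w' s)" by (rule norm_cauchy_schwarz)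
      also have "\<dots> \<le> g s * (L * g s + e)"
        using b[OF s] wg[of s] gpos[of s] L e
        by (intro mult_mono) (auto intro: order_trans[OF _ add_right_mono[OF mult_left_mono]])
      finally have gd': "(w s \<bullet> w' s) / g s \<le> L * g s + e"
        using gpos[of s] by (simp add: field_simps)
      have hd: "(h has_real_derivative
          exp (- L * s) * ((w s \<bullet> w' s) / g s) + exp (- L * s) * - L * g s - e) (at s)"
        unfolding h_def by (auto intro!: derivative_eq_intros gd)
      have "exp (- L * s) * ((w s \<bullet> w' s) / g s) \<le> exp (- L * s) * (L * g s + e)"
        using gd' by (intro mult_left_mono) auto
      moreover have "exp (- L * s) * e \<le> 1 * e"
        using L s e by (intro mult_right_mono) auto
      ultimately have "exp (- L * s) * ((w s \<bullet> w' s) / g s) + exp (- L * s) * - L * g s - e \<le> 0"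
        by (simp add: algebra_simps)
      then show "\<exists>y. (h has_real_derivative y) (at s) \<and> y \<le> 0" using hd by blast
    qed
    then have "exp (- L * t) * g t \<le> g 0 + e * t" by (simp add: h_def)
    then have "exp (L * t) * (exp (- L * t) * g t) \<le> exp (L * t) * (g 0 + e * t)"
      by (intro mult_left_mono) auto
    then have 1: "g t \<le> exp (L * t) * (g 0 + e * t)"
      by (simp add: mult.assoc[symmetric] exp_add[symmetric])
    have "g 0 \<le> norm (w 0) + d"
      unfolding g_def using d
      by (intro real_le_lsqrt) (auto simp: power2_sum dot_square_norm)
    then have "exp (L * t) * (g 0 + e * t) \<le> exp (L * t) * (norm (w 0) + d + e * t)"
      by (intro mult_left_mono) auto
    from order_trans[OF order_trans[OF wg 1] this] show ?thesis by (simp add: mult.commute)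
  qed
  note d = this
  have "((\<lambda>d. (norm (w 0) + d + e * t) * exp (L * t)) \<longlongrightarrow> (norm (w 0) + 0 + e * t) * exp (L * t)) (at_right 0)"
    by (intro tendsto_intros)
  then have "norm (w t) \<le> (norm (w 0) + 0 + e * t) * exp (L * t)"
    by (rule tendsto_lowerbound) (auto simp: eventually_at_right_field intro!: exI[of _ 1] d)
  then show ?thesis by simp
qed

lemma gronwall:
  fixes w :: "real \<Rightarrow> 'a::real_inner"
  assumes w: "\<And>s. \<bar>s\<bar> \<le> \<bar>t\<bar> \<Longrightarrow> (w has_vector_derivative w' s) (at s)"
    and b: "\<And>s. \<bar>s\<bar> \<le> \<bar>t\<bar> \<Longrightarrow> norm (w' s) \<le> L * norm (w s) + e"
    and L: "0 \<le> L" and e: "0 \<le> e"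
  shows "norm (w t) \<le> (norm (w 0) + e * \<bar>t\<bar>) * exp (L * \<bar>t\<bar>)"
proof (cases "t \<ge> 0")
  case True
  then show ?thesis using gronwall_nonneg[OF True w b L e] by auto
next
  case False
  have d: "((\<lambda>s. w (- s)) has_vector_derivative - w' (- s)) (at s)" if "0 \<le> s" "s \<le> - t" for s
  proof -
    have "(w has_vector_derivative w' (- s)) (at (- s))" using that False by (intro w) auto
    then have "(w \<circ> uminus has_vector_derivative (-1) *\<^sub>R w' (- s)) (at s)"
      by (intro vector_diff_chain_at) (auto intro!: derivative_eq_intros)
    then show ?thesis by (simp add: o_def)
  qed
  have b': "norm (- w' (- s)) \<le> L * norm (w (- s)) + e" if "0 \<le> s" "s \<le> - t" for s
    using b[of "- s"] that False by simp
  show ?thesis using gronwall_nonneg[of "- t", OF _ d b' L e] False by simp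
qed

section \<open>Global solutions of Lipschitz equations\<close>

lemma antiderivative_exists:
  fixes f :: "real \<Rightarrow> 'a::euclidean_space"
  assumes "continuous_on UNIV f"
  obtains F where "F 0 = 0" "\<And>t. (F has_vector_derivative f t) (at t)"
proof -
  have "\<exists>F. \<forall>x::real. - \<infinity> < ereal x \<longrightarrow> x < \<infinity> \<longrightarrow> (F has_vector_derivative f x) (at x)"
    using assms by (intro einterval_antiderivative) (auto simp: continuous_on_eq_continuous_at)
  then obtain F where F: "\<And>t. (F has_vector_derivative f t) (at t)" by auto
  show thesis
    by (rule that[of "\<lambda>t. F t - F 0"]) (auto intro!: derivative_eq_intros F)
qed

lemma deriv_bound_nonneg:
  fixes F :: "real \<Rightarrow> 'a::real_normed_vector"
  assumes F: "\<And>s. (F has_vector_derivative f s) (at s)"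
    and g: "\<And>s. (g has_real_derivative g' s) (at s)"
    and le: "\<And>s. 0 \<le> s \<Longrightarrow> norm (f s) \<le> g' s" and t: "0 \<le> t"
  shows "norm (F t - F 0) \<le> g t - g 0"
proof (cases "t = 0")
  case False
  have "continuous_on {0..t} F" "continuous_on {0..t} g"
    using has_vector_derivative_continuous[OF F] DERIV_isCont[OF g]
    by (auto intro: continuous_at_imp_continuous_on)
  then show ?thesis using False t g
    by (intro differentiable_bound_general[where f' = f and \<phi>' = g'] F le)
       (auto simp: has_real_derivative_iff_has_vector_derivative[symmetric])
qed simp

lemma deriv_bound_abs:
  fixes F :: "real \<Rightarrow> 'a::real_normed_vector"
  assumes F: "\<And>s. (F has_vector_derivative f s) (at s)"
    and g: "\<And>s. (g has_real_derivative g' s) (at s)"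
    and le: "\<And>s. norm (f s) \<le> g' \<bar>s\<bar>"
  shows "norm (F t - F 0) \<le> g \<bar>t\<bar> - g 0"
proof (cases "t \<ge> 0")
  case True
  then show ?thesis using deriv_bound_nonneg[OF F g _ True] le by (metis abs_of_nonneg)
next
  case False
  have "((\<lambda>s. F (- s)) has_vector_derivative - f (- s)) (at s)" for s
  proof -
    have "(F \<circ> uminus has_vector_derivative (-1) *\<^sub>R f (- s)) (at s)"
      by (intro vector_diff_chain_at F) (auto intro!: derivative_eq_intros)
    then show ?thesis by (simp add: o_def)
  qed
  from deriv_bound_nonneg[OF this g, of "- t"] show ?thesis
    using le False by (metis abs_minus_cancel abs_of_neg abs_of_nonneg le_cases minus_minus neg_0_le_iff_le
        norm_minus_cancel minus_zero)
qed

text \<open>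
  Picard iteration in one step for all times: in the norm weighted by
  \<open>exp (2 * L * \<bar>t\<bar>) * (1 + M \<bar>t\<bar>)\<close>, where \<open>M\<close> is a primitive of \<open>norm (f t x0) + norm (f (- t) x0)\<close>,
  the integral operator is a contraction with factor 1/2.
\<close>

lemma ode_exists:
  fixes f :: "real \<Rightarrow> 'a::euclidean_space \<Rightarrow> 'a"
  assumes cont: "continuous_on UNIV (\<lambda>(t, x). f t x)"
    and lip: "\<And>t x y. norm (f t x - f t y) \<le> L * norm (x - y)" and L: "0 \<le> L"
  obtains u where "u 0 = x0" "\<And>t. (u has_vector_derivative f t (u t)) (at t)"
proof -
  have cf: "continuous_on UNIV (\<lambda>t. f t (v t))" if "continuous_on UNIV v" for v
    using continuous_on_compose2[OF cont continuous_on_Pair[OF continuous_on_id that]] by simp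
  \<comment> \<open>Symmetric in \<open>s\<close>, so that a weight depending on the absolute value
    of time serves both time directions.\<close>
  define h where "h s = norm (f s x0) + norm (f (- s) x0)" for s
  have "continuous_on UNIV (\<lambda>s. f (- s) x0)"
    using continuous_on_compose2[OF cont
        continuous_on_Pair[OF continuous_on_minus[OF continuous_on_id] continuous_on_const]] by simp
  then have "continuous_on UNIV h"
    unfolding h_def by (intro continuous_intros cf)
  then obtain M where M0: "M 0 = 0" and M: "\<And>t. (M has_vector_derivative h t) (at t)"
    by (rule antiderivative_exists) blast
  have M: "(M has_real_derivative h t) (at t)" for t
    using M by (simp add: has_real_derivative_iff_has_vector_derivative)
  have hpos: "h s \<ge> 0" for s by (simp add: h_def)
  have hle: "norm (f s x0) \<le> h \<bar>s\<bar>" for s by (cases "s \<ge> 0") (auto simp: h_def)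
  have Mpos: "M s \<ge> 0" if "s \<ge> 0" for s
    using DERIV_nonneg_imp_nondecreasing[OF that, of M] M hpos M0 by force
  define E where "E s = exp (2 * L * s) * (1 + M s)" for s
  have Ege: "1 + M \<bar>s\<bar> \<le> E \<bar>s\<bar>" for s
    using Mpos[of "\<bar>s\<bar>"] L mult_right_mono[of 1 "exp (2 * L * \<bar>s\<bar>)" "1 + M \<bar>s\<bar>"] by (simp add: E_def)
  have E1: "1 \<le> E \<bar>s\<bar>" "0 < E \<bar>s\<bar>" for s
    using Mpos[of "\<bar>s\<bar>"] Ege[of s] by auto
  have E': "(E has_real_derivative (2 * L * E s + exp (2 * L * s) * h s)) (at s)" for s
    unfolding E_def by (auto intro!: derivative_eq_intros M simp: algebra_simps)
  have contM: "continuous_on UNIV M" using DERIV_isCont[OF M] by (simp add: continuous_on_eq_continuous_at)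
  have contE: "continuous_on UNIV (\<lambda>s. E \<bar>s\<bar>)"
    unfolding E_def by (intro continuous_intros continuous_on_compose2[OF contM]) auto
  \<comment> \<open>The unknown curve is written as \<open>x0\<close> plus the weight
    \<open>E\<close> times a bounded continuous \<open>w\<close>; the fixed point is sought in the
    complete space of such \<open>w\<close>.\<close>
  define k where "k w s = f s (x0 + E \<bar>s\<bar> *\<^sub>R apply_bcontfun w s)" for w s
  have ck: "continuous_on UNIV (k w)" for w
    unfolding k_def by (intro cf continuous_intros contE continuous_on_apply_bcontfun)
  have "\<forall>w. \<exists>F. F 0 = 0 \<and> (\<forall>t. (F has_vector_derivative k w t) (at t))"
    using antiderivative_exists[OF ck] by metis
  then obtain \<Phi> where \<Phi>0: "\<And>w. \<Phi> w 0 = 0"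
    and \<Phi>: "\<And>w t. (\<Phi> w has_vector_derivative k w t) (at t)"
    by metis
  \<comment> \<open>The exponent \<open>2 * L\<close> in \<open>E\<close> makes the derivative of
    \<open>(K / 2) * E\<close> at least \<open>K * L * E\<close> at nonnegative times. Integrating a
    difference of fields of size \<open>K * L * E\<close> thus costs only \<open>K / 2\<close> in
    the weighted norm: this is the contraction factor.\<close>
  have EK: "((\<lambda>s. (K / 2) * E s) has_real_derivative (K * L * E s + (K / 2) * (exp (2 * L * s) * h s))) (at s)" for K s
    by (auto intro!: derivative_eq_intros E' simp: algebra_simps)
  have "\<exists>v :: real \<Rightarrow>\<^sub>C 'a. \<forall>t. apply_bcontfun v t = \<Phi> w t /\<^sub>R E \<bar>t\<bar>" for w
  proof -
    have le: "norm (k w s) \<le> h \<bar>s\<bar> + (norm w * L * E \<bar>s\<bar> + (norm w / 2) * (exp (2 * L * \<bar>s\<bar>) * h \<bar>s\<bar>))" for s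
    proof -
      have "norm (k w s) \<le> norm (f s x0) + norm (k w s - f s x0)"
        using norm_triangle_sub by blast
      also have "norm (k w s - f s x0) \<le> L * norm (E \<bar>s\<bar> *\<^sub>R apply_bcontfun w s)"
        using lip[of s "x0 + E \<bar>s\<bar> *\<^sub>R apply_bcontfun w s" x0] by (simp add: k_def)
      also have "\<dots> \<le> L * (E \<bar>s\<bar> * norm w)"
        using E1[of s] norm_bounded[of w s] L by (intro mult_left_mono) (auto intro: mult_left_mono)
      finally have "norm (k w s) \<le> norm (f s x0) + L * (E \<bar>s\<bar> * norm w)" by simp
      moreover have "0 \<le> (norm w / 2) * (exp (2 * L * \<bar>s\<bar>) * h \<bar>s\<bar>)" using hpos by simp
      ultimately show ?thesis using hle[of s] by (simp add: mult_ac)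
    qed
    have "norm (\<Phi> w t) \<le> (1 + norm w / 2) * E \<bar>t\<bar>" for t
    proof -
      have "norm (\<Phi> w t - \<Phi> w 0) \<le> (M \<bar>t\<bar> + (norm w / 2) * E \<bar>t\<bar>) - (M 0 + (norm w / 2) * E 0)"
        by (rule deriv_bound_abs[OF \<Phi> DERIV_add[OF M EK] le])
      moreover have "E 0 = 1" by (simp add: E_def M0)
      ultimately have "norm (\<Phi> w t) + norm w / 2 \<le> M \<bar>t\<bar> + norm w * E \<bar>t\<bar> / 2"
        by (simp add: \<Phi>0 M0)
      then have "norm (\<Phi> w t) \<le> E \<bar>t\<bar> + norm w * E \<bar>t\<bar> / 2"
        using Ege[of t] norm_ge_zero[of w] by linarith
      then show ?thesis by (simp add: algebra_simps)
    qed
    then have "norm (\<Phi> w t /\<^sub>R E \<bar>t\<bar>) \<le> 1 + norm w / 2" for t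
      using E1[of t] by (simp add: divide_simps mult.commute)
    moreover have "continuous_on UNIV (\<lambda>t. \<Phi> w t /\<^sub>R E \<bar>t\<bar>)"
      using has_vector_derivative_continuous[OF \<Phi>] E1(2)
      by (intro continuous_intros contE)
         (auto simp: continuous_on_eq_continuous_at less_imp_neq[OF E1(2), THEN not_sym])
    ultimately have "(\<lambda>t. \<Phi> w t /\<^sub>R E \<bar>t\<bar>) \<in> bcontfun" by (intro bcontfun_normI)
    then obtain v where v: "(\<lambda>t. \<Phi> w t /\<^sub>R E \<bar>t\<bar>) = apply_bcontfun v"
      by (rule bcontfunE)
    then show ?thesis by (intro exI[of _ v]) (simp add: fun_cong[OF v[symmetric]])
  qed
  then obtain T :: "(real \<Rightarrow>\<^sub>C 'a) \<Rightarrow> real \<Rightarrow>\<^sub>C 'a"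
    where T: "\<And>w t. apply_bcontfun (T w) t = \<Phi> w t /\<^sub>R E \<bar>t\<bar>"
    by metis
  have "dist (T w) (T v) \<le> (1/2) * dist w v" for w v
  proof (rule dist_bound)
    fix t
    define K where "K = dist w v"
    have K: "K \<ge> 0" by (simp add: K_def)
    have le: "norm (k w s - k v s) \<le> K * L * E \<bar>s\<bar> + (K / 2) * (exp (2 * L * \<bar>s\<bar>) * h \<bar>s\<bar>)" for s
    proof -
      have "norm (k w s - k v s) \<le> L * norm (E \<bar>s\<bar> *\<^sub>R (apply_bcontfun w s - apply_bcontfun v s))"
        using lip[of s "x0 + E \<bar>s\<bar> *\<^sub>R apply_bcontfun w s" "x0 + E \<bar>s\<bar> *\<^sub>R apply_bcontfun v s"]
        by (simp add: k_def algebra_simps)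
      also have "\<dots> \<le> L * (E \<bar>s\<bar> * K)"
        using E1[of s] dist_bounded[of w s v] L
        by (intro mult_left_mono) (auto intro: mult_left_mono simp: dist_norm K_def)
      finally show ?thesis using K hpos[of "\<bar>s\<bar>"] by (simp add: mult_ac add_increasing2)
    qed
    have "norm ((\<Phi> w t - \<Phi> v t) - (\<Phi> w 0 - \<Phi> v 0)) \<le> (K / 2) * E \<bar>t\<bar> - (K / 2) * E 0"
      by (rule deriv_bound_abs[OF has_vector_derivative_diff[OF \<Phi> \<Phi>] EK le])
    also have "\<dots> \<le> (K / 2) * E \<bar>t\<bar>" using K by (simp add: E_def M0)
    finally have "norm (\<Phi> w t - \<Phi> v t) \<le> (K / 2) * E \<bar>t\<bar>" by (simp add: \<Phi>0)
    moreover have "dist (apply_bcontfun (T w) t) (apply_bcontfun (T v) t) = norm (\<Phi> w t - \<Phi> v t) / E \<bar>t\<bar>"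
      unfolding T dist_norm using E1[of t] by (simp add: scaleR_diff_right[symmetric] divide_inverse mult.commute)
    ultimately show "dist (apply_bcontfun (T w) t) (apply_bcontfun (T v) t) \<le> (1/2) * dist w v"
      using E1(2)[of t] by (simp add: K_def pos_divide_le_eq mult_ac)
  qed
  then have "\<exists>!w. T w = w" by (intro banach_fix_type[of "1/2"]) auto
  then obtain w where w: "T w = w" by blast
  have "x0 + E \<bar>t\<bar> *\<^sub>R apply_bcontfun w t = x0 + \<Phi> w t" for t
    using T[of w t] w E1[of t] by simp
  then have "((\<lambda>t. x0 + \<Phi> w t) has_vector_derivative f t (x0 + \<Phi> w t)) (at t)" for t
    using \<Phi>[of w t] unfolding k_def by (auto intro!: derivative_eq_intros)
  then show thesis using that[of "\<lambda>t. x0 + \<Phi> w t"] \<Phi>0 by simp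
qed

section \<open>Smooth dependence on parameters\<close>

lemma uniform_linearization:
  fixes F :: "'b::euclidean_space \<Rightarrow> 'a::real_normed_vector" and c :: "real \<Rightarrow> 'b"
  assumes F: "\<And>y. (F has_derivative DF y) (at y)"
    and DF: "\<And>v. continuous_on UNIV (\<lambda>y. DF y v)"
    and c: "continuous_on UNIV c" and e: "e > 0"
  obtains d where "d > 0" "\<And>s y. \<bar>s\<bar> \<le> T \<Longrightarrow> norm (y - c s) < d \<Longrightarrow>
    norm (F y - F (c s) - DF (c s) (y - c s)) \<le> e * norm (y - c s)"
proof -
  \<comment> \<open>An error \<open>e'\<close> in each basis direction adds up to \<open>e\<close>
    in the operator norm.\<close>
  define e' where "e' = e / real DIM('b)"
  have e': "e' > 0" using e by (simp add: e'_def)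
  \<comment> \<open>Compactness of the time interval yields one neighbourhood that serves all
    \<open>s\<close>; this is the source of the uniformity.\<close>
  have "\<exists>X. open X \<and> 0 \<in> X \<and> (\<forall>x s. x \<in> X \<longrightarrow> \<bar>s\<bar> \<le> T \<longrightarrow> norm (DF (c s + x) i - DF (c s) i) \<le> e')" for i
  proof -
    have "continuous_on UNIV (\<lambda>(x, s). c s + x)"
      unfolding case_prod_beta by (intro continuous_intros continuous_on_compose2[OF c]) auto
    then have "continuous_on UNIV (\<lambda>(x, s). DF (c s + x) i)"
      using continuous_on_compose2[OF DF] by (simp add: case_prod_beta)
    then have "continuous_on (UNIV \<times> cball 0 T) (\<lambda>(x, s). DF (c s + x) i)"
      by (rule continuous_on_subset) auto
    then obtain X where "0 \<in> X" "open X"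
      "\<forall>x\<in>X \<inter> UNIV. \<forall>s\<in>cball 0 T. dist (DF (c s + x) i) (DF (c s + 0) i) \<le> e'"
      using continuous_on_prod_compactE[where U = UNIV and C = "cball 0 T" and ?x0.0 = 0
          and fx = "\<lambda>(x, s). DF (c s + x) i", OF _ compact_cball UNIV_I e']
      unfolding prod.case by blast
    then show ?thesis by (intro exI[of _ X]) (simp add: dist_norm)
  qed
  then obtain X where X: "\<And>i. open (X i)" "\<And>i. 0 \<in> X i"
    "\<And>i x s. x \<in> X i \<Longrightarrow> \<bar>s\<bar> \<le> T \<Longrightarrow> norm (DF (c s + x) i - DF (c s) i) \<le> e'"
    by metis
  have "open (\<Inter>i\<in>Basis. X i)" "0 \<in> (\<Inter>i\<in>Basis. X i)" using X by auto
  then obtain d where d: "d > 0" "ball 0 d \<subseteq> (\<Inter>i\<in>Basis. X i)" by (meson openE)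
  show thesis
  proof (rule that[OF d(1)])
    fix s y assume s: "\<bar>s\<bar> \<le> T" and y: "norm (y - c s) < d"
    have le: "onorm (DF x - DF (c s)) \<le> e" if x: "x \<in> ball (c s) d" for x
    proof (rule onorm_le)
      fix v
      have l: "linear (\<lambda>v. DF x v - DF (c s) v)"
        using F by (intro linear_compose_sub has_derivative_linear)
      have "x - c s \<in> ball 0 d" using x by (simp add: dist_norm norm_minus_commute)
      then have b: "norm (DF x i - DF (c s) i) \<le> e'" if "i \<in> Basis" for i
        using X(3)[of "x - c s" i s] s d(2) that by auto
      have "(DF x - DF (c s)) v = (\<Sum>i\<in>Basis. (v \<bullet> i) *\<^sub>R (DF x i - DF (c s) i))"
        using linear_euclidean_sum[OF l, of v] by simp
      also have "norm \<dots> \<le> (\<Sum>i\<in>(Basis::'b set). norm v * e')"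
        using b e' by (intro sum_norm_le) (auto intro!: mult_mono Basis_le_norm)
      also have "\<dots> = e * norm v" by (simp add: e'_def)
      finally show "norm ((DF x - DF (c s)) v) \<le> e * norm v" .
    qed
    have "norm (F y - F (c s) - DF (c s) (y - c s)) \<le> norm (y - c s) * e"
    proof (rule differentiable_bound_linearization[where S = "ball (c s) d" and f' = DF])
      show "c s + t *\<^sub>R (y - c s) \<in> ball (c s) d" if "t \<in> {0..1}" for t
      proof -
        have "\<bar>t\<bar> * norm (y - c s) \<le> 1 * norm (y - c s)" using that by (intro mult_right_mono) auto
        then show ?thesis using y by (simp add: dist_norm)
      qed
    qed (use F le d in \<open>auto intro: has_derivative_at_withinI\<close>)
    then show "norm (F y - F (c s) - DF (c s) (y - c s)) \<le> e * norm (y - c s)"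
      by (simp add: mult.commute)
  qed
qed

text \<open>Parameter and time form one pair \<open>(p, t)\<close>, the argument of
  \<open>u\<close>, so inserting \<open>u\<close> into the coefficients of the linearized equation
  gives a field of the same type. Initial values may depend on \<open>p\<close>, as they do for a
  flow and for its variation.\<close>

locale parametric_ode =
  fixes F :: "('p::euclidean_space \<times> real) \<times> 'a::euclidean_space \<Rightarrow> 'a"
    and u :: "'p \<times> real \<Rightarrow> 'a" and L :: real
  assumes contF: "continuous_on UNIV F"
    and lip: "norm (F (z, a) - F (z, b)) \<le> L * norm (a - b)"
    and L: "0 \<le> L"
    and sol: "((\<lambda>t. u (p, t)) has_vector_derivative F ((p, t), u (p, t))) (at t)"
    and init: "continuous_on UNIV (\<lambda>p. u (p, 0))"
begin

lemma continuous_in_time: "continuous_on UNIV (\<lambda>t. u (p, t))"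
  using has_vector_derivative_continuous[OF sol] by (simp add: continuous_on_eq_continuous_at)

text \<open>Along the compact curve \<open>u (p0, s)\<close> the fields for \<open>q\<close> near
  \<open>p0\<close> differ uniformly little from the one for \<open>p0\<close>. Gronwall turns this
  and the small initial difference into closeness of the solutions.\<close>

lemma continuous_solution: "continuous_on UNIV u"
proof -
  have "isCont u (p0, t0)" for p0 t0
    unfolding isCont_def tendsto_iff
  proof (intro allI impI)
    fix e :: real assume e: "e > 0"
    define T where "T = \<bar>t0\<bar> + 1"
    \<comment> \<open>Chosen so that the Gronwall bound for initial error \<open>d\<close> and field
      error \<open>d\<close> up to time \<open>T\<close> is \<open>e / 4\<close>. The extra 1 in
      \<open>T\<close> covers times near \<open>t0\<close>.\<close>
    define d where "d = e / (4 * ((1 + T) * exp (L * T)))"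
    have T: "T > 0" by (simp add: T_def)
    then have d: "d > 0" using e by (simp add: d_def)
    have dT: "(d + d * T) * exp (L * T) = e / 4"
    proof -
      have "(1 + T) * exp (L * T) > 0" using T by simp
      then have "d * ((1 + T) * exp (L * T)) = e / 4"
        using T by (simp add: d_def)
      then show ?thesis by (simp add: algebra_simps)
    qed
    have "continuous_on UNIV (\<lambda>(q, s). F ((q, s), u (p0, s)))"
      unfolding case_prod_beta
      by (intro continuous_on_compose2[OF contF] continuous_intros continuous_on_compose2[OF continuous_in_time]) auto
    then have "continuous_on (UNIV \<times> cball 0 T) (\<lambda>(q, s). F ((q, s), u (p0, s)))"
      by (rule continuous_on_subset) auto
    then obtain X0 where X0: "p0 \<in> X0" "open X0" and le:
      "\<forall>q\<in>X0 \<inter> UNIV. \<forall>s\<in>cball 0 T. dist (F ((q, s), u (p0, s))) (F ((p0, s), u (p0, s))) \<le> d"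
      using continuous_on_prod_compactE[where U = UNIV and C = "cball 0 T" and ?x0.0 = p0
          and fx = "\<lambda>(q, s). F ((q, s), u (p0, s))", OF _ compact_cball UNIV_I d]
      unfolding prod.case by blast
    have X0_le: "norm (F ((q, s), u (p0, s)) - F ((p0, s), u (p0, s))) \<le> d" if "q \<in> X0" "\<bar>s\<bar> \<le> T" for q s
      using le that by (auto simp: dist_norm)
    have "((\<lambda>q. u (q, 0)) \<longlongrightarrow> u (p0, 0)) (nhds p0)"
      using init tendsto_at_iff_tendsto_nhds[of "\<lambda>q. u (q, 0)" p0]
      by (simp add: continuous_on_eq_continuous_at isCont_def)
    then have 1: "\<forall>\<^sub>F q in nhds p0. dist (u (q, 0)) (u (p0, 0)) < d"
      using d by (rule tendstoD)
    have 2: "\<forall>\<^sub>F q in nhds p0. q \<in> X0" by (rule eventually_nhds_in_open[OF X0(2,1)])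
    have "((\<lambda>t. u (p0, t)) \<longlongrightarrow> u (p0, t0)) (nhds t0)"
      using continuous_in_time[of p0] tendsto_at_iff_tendsto_nhds[of "\<lambda>t. u (p0, t)" t0]
      by (simp add: continuous_on_eq_continuous_at isCont_def)
    then have 3: "\<forall>\<^sub>F t in nhds t0. dist (u (p0, t)) (u (p0, t0)) < e / 2"
      using e by (intro tendstoD) auto
    have 4: "\<forall>\<^sub>F t in nhds t0. \<bar>t\<bar> \<le> T"
      unfolding eventually_nhds_metric by (rule exI[of _ 1]) (auto simp: T_def dist_real_def)
    have "dist (u (q, t)) (u (p0, t0)) < e"
      if q: "dist (u (q, 0)) (u (p0, 0)) < d" "q \<in> X0"
        and t: "dist (u (p0, t)) (u (p0, t0)) < e / 2" "\<bar>t\<bar> \<le> T" for q t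
    proof -
      have b: "norm (F ((q, s), u (q, s)) - F ((p0, s), u (p0, s))) \<le> L * norm (u (q, s) - u (p0, s)) + d"
        if "\<bar>s\<bar> \<le> \<bar>t\<bar>" for s
        using lip[of "(q, s)" "u (q, s)" "u (p0, s)"] X0_le[OF q(2), of s] that t(2)
          norm_triangle_ineq[of "F ((q, s), u (q, s)) - F ((q, s), u (p0, s))"
            "F ((q, s), u (p0, s)) - F ((p0, s), u (p0, s))"] by simp
      have "norm (u (q, t) - u (p0, t)) \<le> (norm (u (q, 0) - u (p0, 0)) + d * \<bar>t\<bar>) * exp (L * \<bar>t\<bar>)"
        by (rule gronwall[OF has_vector_derivative_diff[OF sol sol] b L]) (use d in auto)
      also have "\<dots> \<le> (d + d * T) * exp (L * T)"
        using q(1) d t(2) T L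
        by (intro mult_mono add_mono) (auto simp: dist_norm intro: mult_left_mono)
      finally have "norm (u (q, t) - u (p0, t)) \<le> e / 4" using dT by simp
      then show ?thesis
        using t(1) dist_triangle[of "u (q, t)" "u (p0, t0)" "u (p0, t)"] e by (simp add: dist_norm)
    qed
    then have "\<forall>\<^sub>F x in nhds p0 \<times>\<^sub>F nhds t0. dist (u x) (u (p0, t0)) < e"
      using eventually_prodI[OF eventually_conj[OF 1 2] eventually_conj[OF 3 4]]
      by (auto elim!: eventually_mono)
    then show "\<forall>\<^sub>F x in at (p0, t0). dist (u x) (u (p0, t0)) < e"
      by (simp add: nhds_prod[symmetric] eventually_at_filter eventually_mono)
  qed
  then show ?thesis by (auto simp: continuous_on_eq_continuous_at)
qed

text \<open>Difference quotients in the state direction are bounded by \<open>L\<close>, and the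
  bound passes to the limit. The variational equation thus inherits the Lipschitz constant.\<close>

lemma norm_derivative_le:
  assumes DF: "(F has_derivative D) (at (z, a))"
  shows "norm (D ((0, 0), w)) \<le> L * norm w"
proof (cases "w = 0")
  case True
  then show ?thesis using linear_0[OF has_derivative_linear[OF DF]] by (simp add: zero_prod_def)
next
  case False
  show ?thesis
  proof (rule field_le_epsilon)
    fix e :: real assume e: "e > 0"
    define e' where "e' = e / norm w"
    have "e' > 0" using e False by (simp add: e'_def)
    then obtain d where d: "d > 0" "\<And>y. norm (y - (z, a)) < d \<Longrightarrow>
        norm (F y - F (z, a) - D (y - (z, a))) \<le> e' * norm (y - (z, a))"
      using DF unfolding has_derivative_at_alt by blast
    define r where "r = d / (2 * norm w)"
    have r: "r > 0" using d False by (simp add: r_def)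
    have nr: "norm (((0, 0), r *\<^sub>R w) :: ('p \<times> real) \<times> 'a) = r * norm w"
      using r by (simp add: norm_Pair)
    have "r * norm w < d" using d False by (simp add: r_def)
    then have "norm (F (z, a + r *\<^sub>R w) - F (z, a) - D ((0, 0), r *\<^sub>R w)) \<le> e' * (r * norm w)"
      using d(2)[of "(z, a + r *\<^sub>R w)"] nr by (simp add: zero_prod_def)
    moreover have "norm (F (z, a + r *\<^sub>R w) - F (z, a)) \<le> L * (r * norm w)"
      using lip[of z "a + r *\<^sub>R w" a] r by simp
    ultimately have "norm (D ((0, 0), r *\<^sub>R w)) \<le> L * (r * norm w) + e' * (r * norm w)"
      using norm_triangle_ineq2[of "D ((0, 0), r *\<^sub>R w)" "F (z, a + r *\<^sub>R w) - F (z, a)"]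
      by (simp add: norm_minus_commute)
    moreover have "norm (D ((0, 0), r *\<^sub>R w)) = r * norm (D ((0, 0), w))"
      using linear_scale[OF has_derivative_linear[OF DF], of r "((0, 0), w)"] r by simp
    moreover have "e' * (r * norm w) = r * e" using False by (simp add: e'_def)
    ultimately have "r * norm (D ((0, 0), w)) \<le> r * (L * norm w + e)" by (simp add: algebra_simps)
    then show "norm (D ((0, 0), w)) \<le> L * norm w + e" using r by simp
  qed
qed

text \<open>\<open>V p h\<close> solves the equation linearized along \<open>u (p, t)\<close>,
  forced by the parameter direction \<open>h\<close> and started at \<open>D0 p h\<close>. It is the
  candidate for the derivative of \<open>u\<close> in direction \<open>h\<close>.\<close>

context
  fixes DF :: "('p \<times> real) \<times> 'a \<Rightarrow> ('p \<times> real) \<times> 'a \<Rightarrow> 'a" and D0 :: "'p \<Rightarrow> 'p \<Rightarrow> 'a"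
    and V :: "'p \<Rightarrow> 'p \<Rightarrow> real \<Rightarrow> 'a"
  assumes DF: "(F has_derivative DF y) (at y)"
    and contDF: "continuous_on UNIV (\<lambda>y. DF y v)"
    and D0: "((\<lambda>p. u (p, 0)) has_derivative D0 p) (at p)"
    and V0: "V p h 0 = D0 p h"
    and V: "(V p h has_vector_derivative DF ((p, t), u (p, t)) ((h, 0), V p h t)) (at t)"
begin

lemma variation_zero:
  assumes "\<And>s. (w has_vector_derivative DF ((p, s), u (p, s)) ((0, 0), w s)) (at s)" "w 0 = 0"
  shows "w t = 0"
  using gronwall[of t w _ L 0, OF assms(1)] norm_derivative_le[OF DF] assms(2) L by simp

text \<open>The defect of additivity or homogeneity solves the homogeneous linearized equation with
  initial value 0, hence vanishes.\<close>

lemma linear_variation: "linear (\<lambda>h. V p h t)"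
proof (rule linearI)
  have lin: "linear (DF y)" "linear (D0 p)" for y using DF D0 has_derivative_linear by blast+
  fix h h' :: 'p and r :: real
  have "V p (h + h') t - (V p h t + V p h' t) = 0"
  proof (rule variation_zero)
    show "((\<lambda>t. V p (h + h') t - (V p h t + V p h' t)) has_vector_derivative
        DF ((p, s), u (p, s)) ((0, 0), V p (h + h') s - (V p h s + V p h' s))) (at s)" for s
      by (rule has_vector_derivative_eq_rhs, rule has_vector_derivative_diff[OF V has_vector_derivative_add[OF V V]])
         (simp add: linear_add[OF lin(1), symmetric] linear_diff[OF lin(1), symmetric] zero_prod_def)
  qed (simp add: V0 linear_add[OF lin(2)])
  then show "V p (h + h') t = V p h t + V p h' t" by simp
  have "V p (r *\<^sub>R h) t - r *\<^sub>R V p h t = 0"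
  proof (rule variation_zero)
    show "((\<lambda>t. V p (r *\<^sub>R h) t - r *\<^sub>R V p h t) has_vector_derivative
        DF ((p, s), u (p, s)) ((0, 0), V p (r *\<^sub>R h) s - r *\<^sub>R V p h s)) (at s)" for s
      by (rule has_vector_derivative_eq_rhs, rule has_vector_derivative_diff[OF V 
            bounded_linear.has_vector_derivative[OF bounded_linear_scaleR_right V]])
         (simp add: linear_scale[OF lin(1), symmetric] linear_diff[OF lin(1), symmetric] zero_prod_def)
  qed (simp add: V0 linear_scale[OF lin(2)])
  then show "V p (r *\<^sub>R h) t = r *\<^sub>R V p h t" by simp
qed

text \<open>The remainder \<open>r\<close> satisfies a linear differential inequality: its
  derivative is the linearization error of \<open>F\<close> plus \<open>DF\<close> applied to
  \<open>r\<close>. Gronwall then bounds \<open>r\<close> by a small multiple of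
  \<open>norm h\<close>.\<close>

lemma has_derivative_parameter: "((\<lambda>p. u (p, t)) has_derivative (\<lambda>h. V p h t)) (at p)"
  unfolding has_derivative_at_alt
proof (intro conjI allI impI)
  show "bounded_linear (\<lambda>h. V p h t)" using linear_variation by (simp add: linear_conv_bounded_linear)
  define T where "T = \<bar>t\<bar>"
  have contV: "continuous_on UNIV (V p h)" for h
    using has_vector_derivative_continuous[OF V] by (auto simp: continuous_on_eq_continuous_at)
  have "\<exists>C\<ge>0. \<forall>s. \<bar>s\<bar> \<le> T \<longrightarrow> norm (V p h s) \<le> C" for h
  proof -
    have "bounded (V p h ` cball 0 T)"
      using contV by (intro compact_imp_bounded compact_continuous_image) (auto intro: continuous_on_subset)
    then obtain C where C: "\<forall>x\<in>V p h ` cball 0 T. norm x \<le> C" unfolding bounded_iff by blast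
    show ?thesis
      by (rule exI[of _ "max C 0"]) (use C in \<open>force simp: dist_real_def\<close>)
  qed
  then obtain C0 where C0: "\<And>h. C0 h \<ge> 0" "\<And>h s. \<bar>s\<bar> \<le> T \<Longrightarrow> norm (V p h s) \<le> C0 h" by metis
  define C where "C = (\<Sum>i\<in>Basis. C0 i)"
  have C: "C \<ge> 0" by (simp add: C_def C0 sum_nonneg)
  have VC: "norm (V p h s) \<le> C * norm h" if "\<bar>s\<bar> \<le> T" for h s
  proof -
    have "V p h s = (\<Sum>i\<in>Basis. (h \<bullet> i) *\<^sub>R V p i s)"
      using linear_euclidean_sum[OF linear_variation] .
    also have "norm \<dots> \<le> (\<Sum>i\<in>Basis. norm h * C0 i)"
      using that by (intro sum_norm_le) (auto intro!: mult_mono Basis_le_norm C0)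
    finally show ?thesis by (simp add: C_def sum_distrib_left mult.commute)
  qed
  \<comment> \<open>The factor Gronwall produces from initial error \<open>e * norm h\<close> and
    forcing \<open>e * (1 + C) * norm h\<close>. The constant is \<open>L + 1\<close> because part
    of the linearization error, \<open>e * norm (r s)\<close>, is absorbed using
    \<open>e \<le> 1\<close>.\<close>
  define K where "K = (1 + (1 + C) * T) * exp ((L + 1) * T)"
  have K: "K > 0" using C unfolding K_def T_def by (intro mult_pos_pos add_pos_nonneg) auto
  fix e0 :: real assume e0: "e0 > 0"
  define e where "e = min 1 (e0 / K)"
  have e: "e > 0" "e \<le> 1" "e * K \<le> e0" using e0 K by (auto simp: e_def min_def field_simps)
  define c where "c s = ((p, s), u (p, s))" for s
  have contc: "continuous_on UNIV c"
    unfolding c_def by (intro continuous_intros continuous_in_time)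
  obtain d where d: "d > 0" "\<And>s y. \<bar>s\<bar> \<le> T \<Longrightarrow> norm (y - c s) < d \<Longrightarrow>
      norm (F y - F (c s) - DF (c s) (y - c s)) \<le> e * norm (y - c s)"
    using uniform_linearization[OF DF contDF contc e(1)] by blast
  have "continuous_on (UNIV \<times> cball 0 T) u"
    by (rule continuous_on_subset[OF continuous_solution]) auto
  moreover have "d / 2 > 0" using d(1) by simp
  ultimately obtain X where "p \<in> X" "open X"
      "\<forall>q\<in>X \<inter> UNIV. \<forall>s\<in>cball 0 T. dist (u (q, s)) (u (p, s)) \<le> d / 2"
    by (rule continuous_on_prod_compactE[OF _ compact_cball UNIV_I])
  then have X: "p \<in> X" "open X" "\<And>q s. q \<in> X \<Longrightarrow> \<bar>s\<bar> \<le> T \<Longrightarrow> norm (u (q, s) - u (p, s)) \<le> d/2"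
    by (auto simp: dist_norm)
  obtain d1 where d1: "d1 > 0" "ball p d1 \<subseteq> X" using X openE by blast
  obtain d2 where d2: "d2 > 0"
    "\<And>q. norm (q - p) < d2 \<Longrightarrow> norm (u (q, 0) - u (p, 0) - D0 p (q - p)) \<le> e * norm (q - p)"
    using D0[of p] e(1) unfolding has_derivative_at_alt by blast
  show "\<exists>d>0. \<forall>q. norm (q - p) < d \<longrightarrow> norm (u (q, t) - u (p, t) - V p (q - p) t) \<le> e0 * norm (q - p)"
  \<comment> \<open>The bound \<open>d / 2\<close> controls the parameter part of
    \<open>y - c s\<close>, \<open>d1\<close> keeps its state part within \<open>d / 2\<close>, and
    \<open>d2\<close> controls the initial values.\<close>
  proof (intro exI[of _ "min (d/2) (min d1 d2)"] conjI allI impI)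
    fix q assume q: "norm (q - p) < min (d/2) (min d1 d2)"
    define h where "h = q - p"
    define r where "r s = u (q, s) - u (p, s) - V p h s" for s
    have qX: "q \<in> X" using q d1 by (auto simp: dist_norm norm_minus_commute)
    define r' where "r' s = F ((q, s), u (q, s)) - F (c s) - DF (c s) ((h, 0), V p h s)" for s
    have rd: "(r has_vector_derivative r' s) (at s)" for s
      unfolding r_def r'_def c_def by (intro has_vector_derivative_diff sol V)
    have rb: "norm (r' s) \<le> (L + 1) * norm (r s) + e * (1 + C) * norm h" if s: "\<bar>s\<bar> \<le> \<bar>t\<bar>" for s
    proof -
      have s: "\<bar>s\<bar> \<le> T" using that by (simp add: T_def)
      define y where "y = ((q, s), u (q, s))"
      have yc: "y - c s = ((h, 0), u (q, s) - u (p, s))" by (simp add: y_def c_def h_def)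
      have ny: "norm (y - c s) \<le> norm h + norm (u (q, s) - u (p, s))"
        unfolding yc using norm_Pair_le[of "(h, 0::real)" "u (q, s) - u (p, s)"] by simp
      then have "norm (y - c s) < d" using X(3)[OF qX s] q by (simp add: h_def)
      then have 1: "norm (F y - F (c s) - DF (c s) (y - c s)) \<le> e * norm (y - c s)" using d s by blast
      have "norm (u (q, s) - u (p, s)) \<le> norm (r s) + C * norm h"
        using VC[OF s, of h] norm_triangle_ineq[of "r s" "V p h s"] by (simp add: r_def)
      then have "e * norm (y - c s) \<le> e * (norm (r s) + (1 + C) * norm h)"
        using ny e by (intro mult_left_mono) (auto simp: algebra_simps)
      also have "\<dots> \<le> norm (r s) + e * (1 + C) * norm h"
        using e mult_right_mono[of e 1 "norm (r s)"] by (simp add: algebra_simps)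
      finally have 2: "e * norm (y - c s) \<le> norm (r s) + e * (1 + C) * norm h" .
      have "y - c s = ((h, 0), V p h s) + ((0, 0), r s)" by (simp add: yc r_def)
      then have "DF (c s) (y - c s) = DF (c s) ((h, 0), V p h s) + DF (c s) ((0, 0), r s)"
        using linear_add[OF has_derivative_linear[OF DF]] by metis
      then have "r' s = (F y - F (c s) - DF (c s) (y - c s)) + DF (c s) ((0, 0), r s)"
        by (simp add: r'_def y_def)
      then have "norm (r' s) \<le> norm (F y - F (c s) - DF (c s) (y - c s)) + norm (DF (c s) ((0, 0), r s))"
        by (metis norm_triangle_ineq)
      also have "norm (DF (c s) ((0, 0), r s)) \<le> L * norm (r s)"
        unfolding c_def by (rule norm_derivative_le[OF DF])
      finally show ?thesis using 1 2 by (simp add: algebra_simps)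
    qed
    have "norm (r t) \<le> (norm (r 0) + (e * (1 + C) * norm h) * \<bar>t\<bar>) * exp ((L + 1) * \<bar>t\<bar>)"
      by (rule gronwall[OF rd rb]) (use L C e in auto)
    also have "\<dots> \<le> (e * norm h + (e * (1 + C) * norm h) * T) * exp ((L + 1) * T)"
    proof -
      have "norm (r 0) \<le> e * norm h" using d2(2)[of q] q by (simp add: r_def V0 h_def)
      then show ?thesis unfolding T_def by (intro mult_right_mono add_right_mono) auto
    qed
    also have "\<dots> = (e * K) * norm h" by (simp add: K_def algebra_simps)
    also have "\<dots> \<le> e0 * norm h" using e by (intro mult_right_mono) auto
    finally show "norm (u (q, t) - u (p, t) - V p (q - p) t) \<le> e0 * norm (q - p)"
      by (simp add: r_def h_def)
  qed (use d d1 d2 in auto)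
qed

text \<open>Two partial derivatives combine into a total one when one of them is continuous; here it
  is the time derivative \<open>F (z, u z)\<close>.\<close>

lemma has_derivative_solution:
  "(u has_derivative (\<lambda>(h, \<tau>). V p h t + \<tau> *\<^sub>R F ((p, t), u (p, t)))) (at (p, t))"
proof -
  have "continuous_on UNIV (\<lambda>z. F (z, u z))"
    by (intro continuous_on_compose2[OF contF] continuous_intros continuous_solution) auto
  then have "continuous (at (p, t)) (\<lambda>(p, t). blinfun_scaleR_left (F ((p, t), u (p, t))))"
    unfolding case_prod_beta prod.collapse
    by (auto simp: continuous_on_eq_continuous_at intro!: bounded_linear.continuous[OF bounded_linear_blinfun_scaleR_left])
  then have "((\<lambda>(p, t). u (p, t)) has_derivative
      (\<lambda>(h, \<tau>). V p h t + blinfun_scaleR_left (F ((p, t), u (p, t))) \<tau>)) (at (p, t) within UNIV \<times> UNIV)"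
    by (intro has_derivative_partialsI has_derivative_parameter)
       (use sol in \<open>auto simp: has_vector_derivative_def\<close>)
  then show ?thesis by simp
qed

end

end

text \<open>
  The derivative in the parameter solves the variational equation, which has the same form and the
  same Lipschitz constant, so the induction on \<open>k\<close> stays within one pair of types.
\<close>

lemma Ck_ode_solution:
  fixes F :: "('p::euclidean_space \<times> real) \<times> 'a::euclidean_space \<Rightarrow> 'a"
  assumes "Ck_on k UNIV F" "Ck_on k UNIV (\<lambda>p. u (p, 0))"
    and "\<And>z a b. norm (F (z, a) - F (z, b)) \<le> L * norm (a - b)" and L: "0 \<le> L"
    and "\<And>p t. ((\<lambda>t. u (p, t)) has_vector_derivative F ((p, t), u (p, t))) (at t)"
  shows "Ck_on k UNIV u"
  using assms(1-3,5)
proof (induction k arbitrary: F u)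
  case 0
  interpret parametric_ode F u L
    using 0 L by unfold_locales auto
  show ?case using continuous_solution by simp
next
  case (Suc k)
  interpret parametric_ode F u L
    by unfold_locales
      (use Suc.prems(3,4) L Suc.prems(1,2)[THEN Ck_on_continuous_on] in auto)
  define DF where "DF y = frechet_derivative F (at y)" for y
  define D0 where "D0 p = frechet_derivative (\<lambda>p. u (p, 0)) (at p)" for p
  have DF: "(F has_derivative DF y) (at y)" and CDF: "Ck_on k UNIV (\<lambda>y. DF y v)" for y v
    unfolding DF_def using Ck_SucD[OF Suc.prems(1)] by auto
  have D0: "((\<lambda>p. u (p, 0)) has_derivative D0 p) (at p)" and CD0: "Ck_on k UNIV (\<lambda>p. D0 p v)" for p v
    unfolding D0_def using Ck_SucD[OF Suc.prems(2)] by auto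
  have lin: "linear (DF y)" for y using DF has_derivative_linear by blast
  \<comment> \<open>\<open>u\<close> enters the coefficients of its own variational equation, so
    order \<open>k\<close> for \<open>u\<close> comes before order \<open>k\<close> for the
    variation.\<close>
  have Cu: "Ck_on k UNIV u"
    using Suc.IH[OF Suc.prems(1)[THEN Ck_on_SucD] Suc.prems(2)[THEN Ck_on_SucD]] Suc.prems(3,4) by blast
  have Cz: "Ck_on k UNIV (\<lambda>z. DF (z, u z) v)" for v
    by (intro Ck_compose[OF CDF] Ck_Pair Ck_ident Cu)
  define G where "G h y = DF (fst y, u (fst y)) ((h, 0), snd y)" for h and y :: "('p \<times> real) \<times> 'a"
  have CG: "Ck_on k UNIV (G h)" for h
  proof -
    have l: "linear (\<lambda>w. DF z ((0, 0), w))" for z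
      using linear_add[OF lin, of z "((0, 0), _)" "((0, 0), _)"] linear_scale[OF lin, of z _ "((0, 0), _)"]
      by (intro linearI) simp_all
    \<comment> \<open>The state \<open>w\<close> enters affinely, so expanding it in the basis
      leaves only coefficients with fixed directions.\<close>
    have "DF z ((h, 0), w) = DF z ((h, 0), 0) + (\<Sum>i\<in>Basis. (w \<bullet> i) *\<^sub>R DF z ((0, 0), i))" for z w
      using linear_add[OF lin, of z "((h, 0), 0)" "((0, 0), w)"] linear_euclidean_sum[OF l, of z w] by simp
    then have "G h = (\<lambda>y. DF (fst y, u (fst y)) ((h, 0), 0)
        + (\<Sum>i\<in>Basis. (snd y \<bullet> i) *\<^sub>R DF (fst y, u (fst y)) ((0, 0), i)))"
      unfolding G_def by blast
    then show ?thesis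
      by (auto intro!: Ck_add Ck_sum Ck_scaleR Ck_inner Ck_const Ck_snd Ck_ident
          Ck_compose[OF Cz] Ck_fst)
  qed
  have Gdiff: "G h (z, a) - G h (z, b) = DF (z, u z) ((0, 0), a - b)" for h z a b
    unfolding G_def by (simp add: linear_diff[OF lin, symmetric] zero_prod_def)
  have Glip: "norm (G h (z, a) - G h (z, b)) \<le> L * norm (a - b)" for h z a b
    unfolding Gdiff by (rule norm_derivative_le[OF DF])
  have "\<exists>w. w 0 = D0 p h \<and> (\<forall>t. (w has_vector_derivative G h ((p, t), w t)) (at t))" for p h
  proof -
    have "continuous_on UNIV (\<lambda>(t, x). G h ((p, t), x))"
      unfolding case_prod_beta
      by (intro continuous_on_compose2[OF Ck_on_continuous_on[OF CG]] continuous_intros) auto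
    then show ?thesis using ode_exists[of "\<lambda>t x. G h ((p, t), x)" L "D0 p h"] Glip L by metis
  qed
  then obtain V where V0: "\<And>p h. V p h 0 = D0 p h"
    and V: "\<And>p h t. (V p h has_vector_derivative G h ((p, t), V p h t)) (at t)" by metis
  have V: "(V p h has_vector_derivative DF ((p, t), u (p, t)) ((h, 0), V p h t)) (at t)" for p h t
    using V by (simp add: G_def)
  have Du: "(u has_derivative (\<lambda>v. V (fst z) (fst v) (snd z) + snd v *\<^sub>R F (z, u z))) (at z)" for z
    using has_derivative_solution[OF DF Ck_on_continuous_on[OF CDF] D0 V0 V, of "fst z" "snd z"]
    by (simp add: case_prod_unfold)
  have CV: "Ck_on k UNIV (\<lambda>z. V (fst z) h (snd z))" for h
    by (rule Suc.IH[OF CG[of h] _ Glip]) (use CD0 V in \<open>auto simp: V0 G_def\<close>)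
  show ?case
    by (rule Ck_SucI[OF Du])
       (intro Ck_add Ck_scaleR Ck_const CV Ck_compose[OF Ck_on_SucD[OF Suc.prems(1)]] Ck_Pair Ck_ident Cu)
qed

section \<open>Flows of Lipschitz fields\<close>

lemma autonomous_flow:
  fixes X :: "'a::euclidean_space \<Rightarrow> 'a"
  assumes X: "\<And>k. Ck_on k UNIV X" and lip: "\<And>p q. norm (X p - X q) \<le> L * norm (p - q)"
    and L: "0 \<le> L"
  obtains \<psi> V where "\<And>p. \<psi> 0 p = p" "\<And>t p. ((\<lambda>t. \<psi> t p) has_vector_derivative X (\<psi> t p)) (at t)"
    "\<And>k. Ck_on k UNIV (\<lambda>(t, p). \<psi> t p)"
    "\<And>s t p. \<psi> s (\<psi> t p) = \<psi> (s + t) p"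
    "\<And>t p. (\<psi> t has_derivative V t p) (at p)" "\<And>p h. V 0 p h = h"
    "\<And>t p h. ((\<lambda>t. V t p h) has_vector_derivative frechet_derivative X (at (\<psi> t p)) (V t p h)) (at t)"
proof -
  have "\<exists>u. u 0 = p \<and> (\<forall>t. (u has_vector_derivative X (u t)) (at t))" for p
  proof -
    have "continuous_on UNIV (\<lambda>(t::real, x). X x)"
      unfolding case_prod_beta
      by (intro continuous_on_compose2[OF Ck_on_continuous_on[OF X]] continuous_intros) auto
    from ode_exists[OF this lip L] show ?thesis by metis
  qed
  then obtain u where u0: "\<And>p. u p 0 = p" and u: "\<And>p t. (u p has_vector_derivative X (u p t)) (at t)"
    by metis
  define \<psi> where "\<psi> t p = u p t" for t p
  have \<psi>0: "\<psi> 0 p = p" for p by (simp add: \<psi>_def u0)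
  have \<psi>: "((\<lambda>t. \<psi> t p) has_vector_derivative X (\<psi> t p)) (at t)" for t p
    using u[of p t] by (simp add: \<psi>_def[abs_def])
  have "Ck_on k UNIV (\<lambda>(p, t). \<psi> t p)" for k
    by (rule Ck_ode_solution[where F = "\<lambda>y. X (snd y)" and L = L])
       (use \<psi> lip L in \<open>auto simp: \<psi>0 intro!: Ck_compose[OF X] Ck_snd Ck_ident\<close>)
  moreover have "Ck_on k UNIV (\<lambda>z::real \<times> 'a. (snd z, fst z))" for k
    by (intro Ck_Pair Ck_fst Ck_snd Ck_ident)
  ultimately have "Ck_on k UNIV (\<lambda>z. (\<lambda>(p, t). \<psi> t p) (snd z, fst z))" for k
    by (rule Ck_compose)
  then have Ck\<psi>: "Ck_on k UNIV (\<lambda>(t, p). \<psi> t p)" for k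
    by (simp add: case_prod_unfold)
  have group: "\<psi> s (\<psi> t p) = \<psi> (s + t) p" for s t p
  proof -
    have d: "((\<lambda>s. \<psi> s (\<psi> t p) - \<psi> (s + t) p) has_vector_derivative
        X (\<psi> s (\<psi> t p)) - X (\<psi> (s + t) p)) (at s)" for s
    proof -
      have "((\<lambda>t. \<psi> t p) \<circ> (\<lambda>s. s + t) has_vector_derivative 1 *\<^sub>R X (\<psi> (s + t) p)) (at s)"
        by (intro vector_diff_chain_at \<psi>) (auto intro!: derivative_eq_intros)
      then show ?thesis by (intro has_vector_derivative_diff \<psi>) (simp add: o_def)
    qed
    \<comment> \<open>In \<open>s\<close>, both curves solve the same equation with the same initial
      value, so the Gronwall bound is 0.\<close>
    have "norm (\<psi> s (\<psi> t p) - \<psi> (s + t) p) \<le>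
        (norm (\<psi> 0 (\<psi> t p) - \<psi> (0 + t) p) + 0 * \<bar>s\<bar>) * exp (L * \<bar>s\<bar>)"
      by (rule gronwall[OF d]) (use lip L in auto)
    then show ?thesis by (simp add: \<psi>0)
  qed
  interpret parametric_ode "\<lambda>y. X (snd y)" "\<lambda>(p, t). \<psi> t p" L
    using lip L \<psi> Ck_on_continuous_on[OF X]
      continuous_on_compose2[OF Ck_on_continuous_on[OF X] continuous_on_snd[OF continuous_on_id]]
    by unfold_locales (auto simp: \<psi>0)
  define X' where "X' q = frechet_derivative X (at q)" for q
  have X': "(X has_derivative X' q) (at q)" and CX': "Ck_on k UNIV (\<lambda>q. X' q v)" for q k v
    unfolding X'_def using Ck_SucD[OF X] by auto
  have DF: "((\<lambda>y. X (snd y)) has_derivative (\<lambda>v. X' (snd y) (snd v))) (at y)" for y :: "('a \<times> real) \<times> 'a"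
    by (rule has_derivative_compose[OF has_derivative_snd[OF has_derivative_ident] X'])
  have X'_le: "norm (X' q w) \<le> L * norm w" for q w
    using norm_derivative_le[OF DF[of "(undefined, q)", unfolded snd_conv], of w] by simp
  have ct: "continuous_on UNIV (\<lambda>t. \<psi> t p)" for p
    using has_vector_derivative_continuous[OF \<psi>] by (simp add: continuous_on_eq_continuous_at)
  have "\<exists>w. w 0 = h \<and> (\<forall>t. (w has_vector_derivative X' (\<psi> t p) (w t)) (at t))" for p h
  proof -
    have "(\<lambda>(t, w). X' (\<psi> t p) w) = (\<lambda>(t, w). \<Sum>i\<in>Basis. (w \<bullet> i) *\<^sub>R X' (\<psi> t p) i)"
      unfolding case_prod_unfold
      by (rule ext, rule linear_euclidean_sum[OF has_derivative_linear[OF X']])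
    moreover have "continuous_on UNIV (\<lambda>(t, w). \<Sum>i\<in>Basis. (w \<bullet> i) *\<^sub>R X' (\<psi> t p) i)"
      unfolding case_prod_beta
      by (intro continuous_intros continuous_on_compose2[OF Ck_on_continuous_on[OF CX']]
          continuous_on_compose2[OF ct]) auto
    ultimately have "continuous_on UNIV (\<lambda>(t, w). X' (\<psi> t p) w)" by simp
    moreover have "norm (X' (\<psi> t p) v - X' (\<psi> t p) w) \<le> L * norm (v - w)" for t v w
      using X'_le[of "\<psi> t p" "v - w"] by (simp add: linear_diff[OF has_derivative_linear[OF X']])
    ultimately show ?thesis using ode_exists[of "\<lambda>t w. X' (\<psi> t p) w" L h] L by metis
  qed
  note ex = this
  define W where "W p h = (SOME w. w 0 = h \<and> (\<forall>t. (w has_vector_derivative X' (\<psi> t p) (w t)) (at t)))" for p h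
  have W0: "W p h 0 = h" and W: "(W p h has_vector_derivative X' (\<psi> t p) (W p h t)) (at t)" for p h t
    using someI_ex[OF ex[of h p]] unfolding W_def by blast+
  have dW: "(\<psi> t has_derivative (\<lambda>h. W p h t)) (at p)" for t p
    using has_derivative_parameter[of "\<lambda>y v. X' (snd y) (snd v)" "\<lambda>p h. h" W, OF DF] W0 W
    by (simp add: \<psi>0 Ck_on_continuous_on[OF CX'] continuous_on_compose2[OF Ck_on_continuous_on[OF CX'] continuous_on_snd[OF continuous_on_id]])
  show thesis
    by (rule that[of \<psi> "\<lambda>t p h. W p h t", OF \<psi>0 \<psi> Ck\<psi> group dW W0]) (use W X'_def in auto)
qed

text \<open>The derivative is bounded on a ball by compactness and vanishes outside it, so the mean
  value inequality applies globally.\<close>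

lemma compact_support_lipschitz:
  fixes f :: "'a::euclidean_space \<Rightarrow> 'b::real_normed_vector"
  assumes f: "Ck_on 1 UNIV f" and supp: "\<And>x. norm x > r \<Longrightarrow> f x = 0"
  obtains L where "0 \<le> L" "\<And>x y. norm (f x - f y) \<le> L * norm (x - y)"
proof -
  define f' where "f' x = frechet_derivative f (at x)" for x
  have f': "(f has_derivative f' x) (at x)" and C: "continuous_on UNIV (\<lambda>x. f' x v)" for x v
    using Ck_SucD[of 0 f] f by (auto simp: f'_def)
  have "\<exists>B\<ge>0. \<forall>x. norm (f' x i) \<le> B" for i
  proof -
    have "bounded ((\<lambda>x. f' x i) ` cball 0 r)"
      using C by (intro compact_imp_bounded compact_continuous_image) (auto intro: continuous_on_subset)
    then obtain B where B: "\<forall>y\<in>(\<lambda>x. f' x i) ` cball 0 r. norm y \<le> B" unfolding bounded_iff by blast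
    have "f' x i = 0" if "norm x > r" for x
    proof -
      have "((\<lambda>x. 0) has_derivative f' x) (at x)"
        by (rule has_derivative_transform_within_open[OF f', of "- cball 0 r"]) (use that supp in auto)
      then have "f' x = (\<lambda>h. 0)" using has_derivative_unique has_derivative_const by blast
      then show ?thesis by simp
    qed
    then have "norm (f' x i) \<le> max B 0" for x
      using B by (cases "norm x > r") (auto simp: not_less le_max_iff_disj)
    then show ?thesis by (intro exI[of _ "max B 0"]) auto
  qed
  then obtain B where B: "\<And>i. B i \<ge> 0" "\<And>i x. norm (f' x i) \<le> B i" by metis
  define L where "L = (\<Sum>i\<in>Basis. B i)"
  have "norm (f x - f y) \<le> L * norm (x - y)" for x y
  proof (rule differentiable_bound[OF convex_UNIV])
    show "(f has_derivative f' x) (at x within UNIV)" for x using f' by simp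
    show "onorm (f' x) \<le> L" for x
    proof (rule onorm_le)
      fix v
      have "norm (f' x v) = norm (\<Sum>i\<in>Basis. (v \<bullet> i) *\<^sub>R f' x i)"
        using linear_euclidean_sum[OF has_derivative_linear[OF f'], of x v] by simp
      also have "\<dots> \<le> (\<Sum>i\<in>(Basis::'a set). norm v * B i)"
        using B by (intro sum_norm_le) (auto intro!: mult_mono Basis_le_norm)
      finally show "norm (f' x v) \<le> L * norm v" by (simp add: L_def sum_distrib_left mult.commute)
    qed
  qed auto
  then show thesis using that[of L] B by (simp add: L_def sum_nonneg)
qed

section \<open>Contact vector fields\<close>

lemma alpha_std_eq: "alpha_std p v = snd (snd v) - fst (snd p) \<bullet> fst v"
  by (cases p; cases v) (simp add: alpha_std_def inner_vec_def)

definition grad_x :: "('n::finite jet \<Rightarrow> real) \<Rightarrow> 'n jet \<Rightarrow> real ^ 'n" where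
  "grad_x F p = (\<Sum>i\<in>Basis. frechet_derivative F (at p) (i, 0, 0) *\<^sub>R i)"

definition grad_y :: "('n::finite jet \<Rightarrow> real) \<Rightarrow> 'n jet \<Rightarrow> real ^ 'n" where
  "grad_y F p = (\<Sum>i\<in>Basis. frechet_derivative F (at p) (0, i, 0) *\<^sub>R i)"

definition diff_z :: "('n::finite jet \<Rightarrow> real) \<Rightarrow> 'n jet \<Rightarrow> real" where
  "diff_z F p = frechet_derivative F (at p) (0, 0, 1)"

text \<open>The contact vector field of \<open>F\<close>: the form takes the value \<open>F\<close>
  on it, and its interior product with the differential of the form is \<open>diff_z F\<close> times
  the form minus the differential of \<open>F\<close>.\<close>

definition contact_field :: "('n::finite jet \<Rightarrow> real) \<Rightarrow> 'n jet \<Rightarrow> 'n jet" where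
  "contact_field F p =
     (- grad_y F p, grad_x F p + diff_z F p *\<^sub>R fst (snd p), F p - fst (snd p) \<bullet> grad_y F p)"

lemma frechet_derivative_jet:
  assumes "F differentiable (at p)"
  shows "frechet_derivative F (at p) v =
    grad_x F p \<bullet> fst v + grad_y F p \<bullet> fst (snd v) + diff_z F p * snd (snd v)"
proof -
  define D where "D = frechet_derivative F (at p)"
  have lin: "linear D" using assms linear_frechet_derivative by (simp add: D_def)
  have l1: "linear (\<lambda>x. D (x, 0, 0))" and l2: "linear (\<lambda>y. D (0, y, 0))"
    using linear_add[OF lin, of "(_, 0, 0)" "(_, 0, 0)"] linear_scale[OF lin, of _ "(_, 0, 0)"]
      linear_add[OF lin, of "(0, _, 0)" "(0, _, 0)"] linear_scale[OF lin, of _ "(0, _, 0)"]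
    by (auto intro!: linearI)
  obtain x y z where v: "v = (x, y, z)" by (cases v)
  have "D v = D (x, 0, 0) + D (0, y, 0) + D (0, 0, z)"
    using linear_add[OF lin, of "(x, 0, 0)" "(0, y, 0)"] linear_add[OF lin, of "(x, y, 0)" "(0, 0, z)"]
    by (simp add: v)
  also have "D (x, 0, 0) = grad_x F p \<bullet> x"
    using linear_euclidean_sum[OF l1, of x]
    by (simp add: grad_x_def D_def[symmetric] inner_sum_left inner_commute[of x] mult.commute)
  also have "D (0, y, 0) = grad_y F p \<bullet> y"
    using linear_euclidean_sum[OF l2, of y]
    by (simp add: grad_y_def D_def[symmetric] inner_sum_left inner_commute[of y] mult.commute)
  also have "D (0, 0, z) = diff_z F p * z"
    using linear_scale[OF lin, of z "(0, 0, 1)"] by (simp add: diff_z_def D_def)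
  finally show ?thesis by (simp add: v D_def)
qed

lemma contact_field_eqI:
  assumes "(F has_derivative (\<lambda>v. a \<bullet> fst v + b \<bullet> fst (snd v) + c * snd (snd v))) (at p)"
  shows "contact_field F p = (- b, a + c *\<^sub>R fst (snd p), F p - fst (snd p) \<bullet> b)"
proof -
  have D: "frechet_derivative F (at p) = (\<lambda>v. a \<bullet> fst v + b \<bullet> fst (snd v) + c * snd (snd v))"
    using frechet_derivative_at[OF assms] by simp
  show ?thesis
    by (simp add: contact_field_def grad_x_def grad_y_def diff_z_def D euclidean_representation)
qed

lemma alpha_std_contact_field: "alpha_std p (contact_field F p) = F p"
  by (simp add: alpha_std_eq contact_field_def)

lemma Ck_contact_field:
  assumes "\<And>k. Ck_on k UNIV F"
  shows "Ck_on k UNIV (grad_x F)" "Ck_on k UNIV (grad_y F)" "Ck_on k UNIV (contact_field F)"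
proof -
  have D: "Ck_on k UNIV (\<lambda>p. frechet_derivative F (at p) v)" for v by (rule Ck_SucD(2)[OF assms])
  show x: "Ck_on k UNIV (grad_x F)" and y: "Ck_on k UNIV (grad_y F)"
    unfolding grad_x_def[abs_def] grad_y_def[abs_def]
    by (intro Ck_sum Ck_scaleR D Ck_const)+
  show "Ck_on k UNIV (contact_field F)"
    unfolding contact_field_def[abs_def] diff_z_def
    by (intro Ck_Pair Ck_uminus Ck_add Ck_diff Ck_inner Ck_scaleR x y D assms Ck_fst Ck_snd Ck_ident)
qed

text \<open>
  The Lie derivative of the contact form along the contact field of \<open>F\<close> is \<open>diff_z F\<close> times the
  contact form, so the form evaluated on a transported vector solves a scalar linear equation.
\<close>

lemma contact_flow_kernel:
  fixes F :: "'n::finite jet \<Rightarrow> real"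
  assumes F: "\<And>k. Ck_on k UNIV F"
    and c: "\<And>s. (c has_vector_derivative contact_field F (c s)) (at s)"
    and w: "\<And>s. (w has_vector_derivative frechet_derivative (contact_field F) (at (c s)) (w s)) (at s)"
    and w0: "alpha_std (c 0) (w 0) = 0"
  shows "alpha_std (c t) (w t) = 0"
proof -
  define F' where "F' p = frechet_derivative F (at p)" for p
  define Y' where "Y' p = frechet_derivative (grad_y F) (at p)" for p
  have dF: "(F has_derivative F' p) (at p)" for p
    unfolding F'_def by (rule Ck_SucD(1)[OF F])
  have dY: "(grad_y F has_derivative Y' p) (at p)" for p
    unfolding Y'_def by (rule Ck_SucD(1)[OF Ck_contact_field(2)[OF F]])
  define X' where "X' p = frechet_derivative (contact_field F) (at p)" for p
  have dX: "(contact_field F has_derivative X' p) (at p)" for p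
    unfolding X'_def by (rule Ck_SucD(1)[OF Ck_contact_field(3)[OF F]])
  \<comment> \<open>Differentiating the form along the curve involves only the x and z components of
    the linearized field; the y component enters undifferentiated.\<close>
  have X1: "fst (X' p v) = - Y' p v" for p v
  proof -
    have 1: "((\<lambda>p. fst (contact_field F p)) has_derivative (\<lambda>v. fst (X' p v))) (at p)"
      by (rule has_derivative_fst[OF dX])
    have 2: "((\<lambda>p. fst (contact_field F p)) has_derivative (\<lambda>v. - Y' p v)) (at p)"
      by (simp add: contact_field_def has_derivative_minus[OF dY])
    show ?thesis by (rule fun_cong[OF has_derivative_unique[OF 1 2]])
  qed
  have X3: "snd (snd (X' p v)) = F' p v - (fst (snd p) \<bullet> Y' p v + fst (snd v) \<bullet> grad_y F p)" for p v
  proof -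
    have 1: "((\<lambda>p. snd (snd (contact_field F p))) has_derivative (\<lambda>v. snd (snd (X' p v)))) (at p)"
      by (rule has_derivative_snd[OF has_derivative_snd[OF dX]])
    have 2: "((\<lambda>p. snd (snd (contact_field F p))) has_derivative
        (\<lambda>v. F' p v - (fst (snd p) \<bullet> Y' p v + fst (snd v) \<bullet> grad_y F p))) (at p)"
      unfolding contact_field_def snd_conv
      by (intro has_derivative_diff dF has_derivative_inner dY has_derivative_fst has_derivative_snd has_derivative_ident)
    show ?thesis by (rule fun_cong[OF has_derivative_unique[OF 1 2]])
  qed
  define g where "g s = alpha_std (c s) (w s)" for s
  have g: "(g has_vector_derivative diff_z F (c s) * g s) (at s)" for s
  proof -
    have "((\<lambda>s. snd (snd (w s)) - fst (snd (c s)) \<bullet> fst (w s)) has_vector_derivative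
        snd (snd (X' (c s) (w s))) - (fst (snd (c s)) \<bullet> fst (X' (c s) (w s))
          + fst (snd (contact_field F (c s))) \<bullet> fst (w s))) (at s)"
      unfolding X'_def
      by (intro has_vector_derivative_diff bounded_bilinear.has_vector_derivative[OF bounded_bilinear_inner]
          bounded_linear.has_vector_derivative[OF bounded_linear_fst]
          bounded_linear.has_vector_derivative[OF bounded_linear_snd] c w)
    moreover have "F differentiable (at (c s))" using dF differentiable_def by blast
    note frechet_derivative_jet[OF this, of "w s", folded F'_def]
    ultimately show ?thesis
      unfolding g_def alpha_std_eq X1 X3
      by (simp add: contact_field_def algebra_simps inner_commute inner_add_left inner_add_right)
  qed
  have "continuous_on UNIV (\<lambda>s. diff_z F (c s))"
  proof -
    have "continuous_on UNIV c"
      using has_vector_derivative_continuous[OF c] by (simp add: continuous_on_eq_continuous_at)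
    moreover have "continuous_on UNIV (diff_z F)"
      unfolding diff_z_def[abs_def] by (rule Ck_on_continuous_on[OF Ck_SucD(2)[OF F]])
    ultimately show ?thesis using continuous_on_compose2[of UNIV "diff_z F" UNIV c] by simp
  qed
  \<comment> \<open>A bound is needed only up to time \<open>t\<close>, where compactness of the
    time interval supplies it.\<close>
  then have "bounded ((\<lambda>s. diff_z F (c s)) ` cball 0 \<bar>t\<bar>)"
    by (intro compact_imp_bounded compact_continuous_image) (auto intro: continuous_on_subset)
  then obtain B where B: "\<forall>y\<in>(\<lambda>s. diff_z F (c s)) ` cball 0 \<bar>t\<bar>. norm y \<le> B" "B > 0"
    unfolding bounded_pos by blast
  have b: "norm (diff_z F (c s) * g s) \<le> B * norm (g s) + 0" if "\<bar>s\<bar> \<le> \<bar>t\<bar>" for s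
    using B that by (auto simp: abs_mult dist_real_def intro!: mult_right_mono)
  have "norm (g t) \<le> (norm (g 0) + 0 * \<bar>t\<bar>) * exp (B * \<bar>t\<bar>)"
    by (rule gronwall[OF g b]) (use B in auto)
  then show ?thesis using w0 by (simp add: g_def)
qed

lemma Ck_exp: "Ck_on k UNIV (exp :: real \<Rightarrow> real)"
proof (induction k)
  case (Suc k)
  show ?case
    by (rule Ck_SucI[OF DERIV_exp[unfolded has_field_derivative_def]]) (intro Ck_mult Ck_const Suc.IH)
qed (simp add: continuous_intros)

section \<open>Truncation with prescribed extrema\<close>

lemma clipped_identity:
  fixes M N :: real
  assumes M: "0 \<le> M" "M < N"
  obtains \<sigma> M' m where "\<And>k. Ck_on k UNIV \<sigma>" "M < M'" "\<And>r. \<bar>r\<bar> < M' \<Longrightarrow> \<sigma> r = r"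
    "\<And>r. \<bar>\<sigma> r\<bar> \<le> N" "\<sigma> m = N" "\<sigma> (- m) = - N"
proof -
  define M' where "M' = (M + N) / 2"
  \<comment> \<open>The clipped identity vanishes for \<open>\<bar>r\<bar> \<ge> N\<close>. Bumps of
    radius 1 and heights \<open>N\<close> and \<open>- N\<close> at \<open>m\<close> and
    \<open>- m\<close> avoid \<open>\<bar>r\<bar> < N\<close>, so they create the exact extrema
    without changing the inner part.\<close>
  define m where "m = N + 1"
  have M': "M < M'" "M' < N" "0 < M'" using M by (auto simp: M'_def)
  have sq: "M'\<^sup>2 < N\<^sup>2" using M' M by (intro power_strict_mono) auto
  define \<sigma> where "\<sigma> r = r * cutoff ((r * r - M'\<^sup>2) * inverse (N\<^sup>2 - M'\<^sup>2))
    + N * (cutoff ((r - m) * (r - m)) - cutoff ((r + m) * (r + m)))" for r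
  have far: "cutoff ((r * r - M'\<^sup>2) * inverse (N\<^sup>2 - M'\<^sup>2)) = 0" if "N \<le> \<bar>r\<bar>" for r
  proof (rule cutoff_eq_0)
    have "N\<^sup>2 \<le> r * r" using that M by (simp add: power2_eq_square[symmetric] abs_le_square_iff[symmetric])
    then show "1 \<le> (r * r - M'\<^sup>2) * inverse (N\<^sup>2 - M'\<^sup>2)" using sq by (simp add: field_simps)
  qed
  have bump: "cutoff (r * r) = 0" if "1 \<le> \<bar>r\<bar>" for r
    using that abs_le_square_iff[of 1 r] by (intro cutoff_eq_0) (simp add: power2_eq_square)
  have near: "\<sigma> r = r * cutoff ((r * r - M'\<^sup>2) * inverse (N\<^sup>2 - M'\<^sup>2))" if "\<bar>r\<bar> \<le> N" for r
    using that M bump[of "r - m"] bump[of "r + m"] by (simp add: \<sigma>_def m_def)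
  show thesis
  proof (rule that[of \<sigma> M' m])
    show "Ck_on k UNIV \<sigma>" for k
      unfolding \<sigma>_def[abs_def]
      by (intro Ck_add Ck_mult Ck_diff Ck_compose[OF Ck_cutoff] Ck_const Ck_ident)
    show "\<sigma> r = r" if "\<bar>r\<bar> < M'" for r
    proof -
      have "r * r \<le> M'\<^sup>2" using that M' by (simp add: power2_eq_square[symmetric] abs_le_square_iff[symmetric])
      then have "(r * r - M'\<^sup>2) * inverse (N\<^sup>2 - M'\<^sup>2) \<le> 0"
        using sq by (intro mult_nonpos_nonneg) auto
      then show ?thesis using near[of r] that M' by (simp add: cutoff_eq_1)
    qed
    show "\<bar>\<sigma> r\<bar> \<le> N" for r
    proof (cases "\<bar>r\<bar> \<le> N")
      case True
      have "\<bar>\<sigma> r\<bar> \<le> \<bar>r\<bar> * 1"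
        unfolding near[OF True] abs_mult
        by (rule mult_left_mono) (simp_all add: cutoff_nonneg cutoff_le_1)
      then show ?thesis using True by simp
    next
      case False
      have c: "\<bar>cutoff x - cutoff y\<bar> \<le> 1" for x y
        using cutoff_nonneg[of x] cutoff_nonneg[of y] cutoff_le_1[of x] cutoff_le_1[of y] by simp
      have "\<bar>\<sigma> r\<bar> = N * \<bar>cutoff ((r - m) * (r - m)) - cutoff ((r + m) * (r + m))\<bar>"
        using far[of r] False M by (simp add: \<sigma>_def abs_mult)
      also have "\<dots> \<le> N * 1" using M by (intro mult_left_mono c) auto
      finally show ?thesis by simp
    qed
    show "\<sigma> m = N" "\<sigma> (- m) = - N"
      using far[of m] far[of "- m"] bump[of "2 * m"] bump[of "- 2 * m"] M
      by (simp_all add: \<sigma>_def m_def cutoff_eq_1)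
  qed (rule M')
qed

text \<open>Clipping the values of \<open>l\<close> prescribes the range, and a radial cutoff gives
  compact support. Agreement with \<open>l\<close> is needed on open sets because the contact field
  involves derivatives.\<close>

lemma truncated_hamiltonian:
  fixes l :: "'a::euclidean_space \<Rightarrow> real"
  assumes l: "bounded_linear l" "l \<noteq> (\<lambda>_. 0)" and M: "0 \<le> M" "M < N" and r: "0 \<le> r"
  obtains G \<rho> where "\<And>k. Ck_on k UNIV G" "\<And>p. norm p > \<rho> \<Longrightarrow> G p = 0" "\<And>p. \<bar>G p\<bar> \<le> N"
    "\<exists>p. G p = N" "\<exists>p. G p = - N"
    "\<And>p. norm p \<le> r \<Longrightarrow> \<bar>l p\<bar> \<le> M \<Longrightarrow> \<exists>U. open U \<and> p \<in> U \<and> (\<forall>q\<in>U. G q = l q)"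
proof -
  obtain \<sigma> M' m where \<sigma>: "\<And>k. Ck_on k UNIV \<sigma>" "M < M'" "\<And>r. \<bar>r\<bar> < M' \<Longrightarrow> \<sigma> r = r"
    "\<And>r. \<bar>\<sigma> r\<bar> \<le> N" "\<sigma> m = N" "\<sigma> (- m) = - N"
    using clipped_identity[OF M] by metis
  obtain p0 where p0: "l p0 \<noteq> 0" using l(2) by blast
  define p1 where "p1 = (m / l p0) *\<^sub>R p0"
  have p1: "l p1 = m" "l (- p1) = - m"
    using p0 l(1) by (simp_all add: p1_def linear_simps)
  \<comment> \<open>Large enough for the radial cutoff to be 1 on the ball of radius
    \<open>r\<close> and at the points \<open>p1\<close> and \<open>- p1\<close> where the extrema
    occur.\<close>
  define \<rho> where "\<rho> = r + 1 + norm p1"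
  have \<rho>: "\<rho> > 0" "r < \<rho>" "norm p1 < \<rho>"
    using r by (auto simp: \<rho>_def intro: add_nonneg_pos add_pos_nonneg)
  define G where "G p = \<sigma> (l p) * cutoff (p \<bullet> p - \<rho>\<^sup>2)" for p
  have inside: "G p = \<sigma> (l p)" if "norm p < \<rho>" for p
  proof -
    have "p \<bullet> p \<le> \<rho>\<^sup>2" using that \<rho> by (simp add: dot_square_norm power_mono)
    then show ?thesis by (simp add: G_def cutoff_eq_1)
  qed
  show thesis
  proof (rule that[of G "\<rho> + 1"])
    show "Ck_on k UNIV G" for k
      unfolding G_def[abs_def]
      by (intro Ck_mult Ck_diff Ck_inner Ck_compose[OF Ck_cutoff] Ck_compose[OF \<sigma>(1)] Ck_const Ck_ident
          Ck_linear[OF l(1)])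
    show "G p = 0" if "norm p > \<rho> + 1" for p
    proof -
      have "(\<rho> + 1)\<^sup>2 \<le> p \<bullet> p" using that \<rho> by (simp add: dot_square_norm power_mono)
      moreover have "(\<rho> + 1)\<^sup>2 \<ge> \<rho>\<^sup>2 + 1" using \<rho> by (simp add: power2_eq_square algebra_simps)
      ultimately show ?thesis by (simp add: G_def cutoff_eq_0)
    qed
    show "\<bar>G p\<bar> \<le> N" for p
    proof -
      have "\<bar>G p\<bar> \<le> \<bar>\<sigma> (l p)\<bar> * 1"
        unfolding G_def abs_mult by (rule mult_left_mono) (simp_all add: cutoff_nonneg cutoff_le_1)
      then show ?thesis using \<sigma>(4)[of "l p"] by simp
    qed
    show "\<exists>p. G p = N" using inside[of p1] \<rho> p1 \<sigma> by (intro exI[of _ p1]) simp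
    show "\<exists>p. G p = - N" using inside[of "- p1"] \<rho> p1 \<sigma> by (intro exI[of _ "- p1"]) simp
    show "\<exists>U. open U \<and> p \<in> U \<and> (\<forall>q\<in>U. G q = l q)" if "norm p \<le> r" "\<bar>l p\<bar> \<le> M" for p
    proof (intro exI[of _ "{q. norm q < \<rho>} \<inter> {q. \<bar>l q\<bar> < M'}"] conjI ballI)
      have "continuous_on UNIV l" using l(1) linear_continuous_on by blast
      then show "open ({q. norm q < \<rho>} \<inter> {q. \<bar>l q\<bar> < M'})"
        by (intro open_Int open_Collect_less continuous_intros)
    qed (use that \<rho> \<sigma> inside in auto)
  qed
qed

section \<open>The displacing Hamiltonian\<close>

text \<open>The flow of the contact Hamiltonian \<open>z\<close>. It rescales the contact form and
  leaves \<open>x\<close> fixed, so it compresses the slab without affecting x-projections.\<close>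

definition stretch :: "real \<Rightarrow> 'n::finite jet \<Rightarrow> 'n jet" where
  "stretch s p = (fst p, exp s *\<^sub>R fst (snd p), exp s * snd (snd p))"

lemma stretch_inverse [simp]: "stretch s (stretch (- s) p) = p" "stretch (- s) (stretch s p) = p"
  by (simp_all add: stretch_def exp_add[symmetric] mult.assoc[symmetric])

lemma stretch_0 [simp]: "stretch 0 p = p"
  by (simp add: stretch_def)

lemma bounded_linear_stretch: "bounded_linear (stretch s)"
  unfolding stretch_def[abs_def]
  by (intro bounded_linear_Pair bounded_linear_fst bounded_linear_scaleR_right[THEN bounded_linear_compose]
      bounded_linear_mult_right[THEN bounded_linear_compose]
      bounded_linear_compose[OF bounded_linear_fst bounded_linear_snd]
      bounded_linear_compose[OF bounded_linear_snd bounded_linear_snd])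

lemma alpha_std_stretch: "alpha_std (stretch s p) (stretch s v) = exp s * alpha_std p v"
  by (simp add: alpha_std_eq stretch_def algebra_simps)

lemma norm_stretch_le:
  assumes "s \<le> 0"
  shows "norm (stretch s p) \<le> norm p"
proof -
  have e: "exp s * exp s \<le> 1" using assms by (simp add: exp_add[symmetric])
  obtain x y z where p: "p = (x, y, z)" by (cases p)
  have "(exp s * norm y)\<^sup>2 \<le> (norm y)\<^sup>2" "(exp s * z)\<^sup>2 \<le> z\<^sup>2"
    using mult_right_mono[OF e, of "(norm y)\<^sup>2"] mult_right_mono[OF e, of "z\<^sup>2"]
    by (simp_all add: power2_eq_square mult_ac)
  then show ?thesis by (simp add: p stretch_def norm_Pair power_mult_distrib)
qed

lemma Ck_stretch:
  assumes "Ck_on k UNIV f" "Ck_on k UNIV g"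
  shows "Ck_on k UNIV (\<lambda>x. stretch (f x) (g x))"
  unfolding stretch_def
  by (intro Ck_Pair Ck_scaleR Ck_mult Ck_compose[OF Ck_exp] Ck_fst Ck_snd assms)

text \<open>Both the flow of \<open>contact_field F\<close> and the linear maps
  \<open>stretch\<close> preserve the kernel of the form. The inverse at time \<open>t\<close>
  stretches back and then flows for time \<open>- t\<close>.\<close>

lemma contact_isotopy_stretched_flow:
  fixes F :: "'n::finite jet \<Rightarrow> real"
  assumes F: "\<And>k. Ck_on k UNIV F"
    and lip: "\<And>p q. norm (contact_field F p - contact_field F q) \<le> L * norm (p - q)" and L: "0 \<le> L"
  obtains \<psi> where "\<And>p. \<psi> 0 p = p"
    "\<And>t p. ((\<lambda>t. \<psi> t p) has_vector_derivative contact_field F (\<psi> t p)) (at t)"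
    "contact_isotopy (\<lambda>t p. stretch (- (b * t)) (\<psi> t p))"
proof -
  obtain \<psi> V where \<psi>0: "\<And>p. \<psi> 0 p = p"
    and \<psi>: "\<And>t p. ((\<lambda>t. \<psi> t p) has_vector_derivative contact_field F (\<psi> t p)) (at t)"
    and C\<psi>: "\<And>k. Ck_on k UNIV (\<lambda>(t, p). \<psi> t p)"
    and group: "\<And>s t p. \<psi> s (\<psi> t p) = \<psi> (s + t) p"
    and V: "\<And>t p. (\<psi> t has_derivative V t p) (at p)" and V0: "\<And>p h. V 0 p h = h"
    and V': "\<And>t p h. ((\<lambda>t. V t p h) has_vector_derivative
      frechet_derivative (contact_field F) (at (\<psi> t p)) (V t p h)) (at t)"
    by (rule autonomous_flow[OF Ck_contact_field(3)[OF F] lip L]) blast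
  define \<phi> where "\<phi> t p = stretch (- (b * t)) (\<psi> t p)" for t p
  have C\<psi>t: "Ck_on k UNIV (\<psi> t)" for k t
    using Ck_compose[OF C\<psi>[of k] Ck_Pair[OF Ck_const[of k t] Ck_ident]] by simp
  have ker: "alpha_std p v = 0 \<Longrightarrow> alpha_std (\<psi> t p) (V t p v) = 0" for t p v
    by (rule contact_flow_kernel[OF F \<psi> V']) (simp add: \<psi>0 V0)
  \<comment> \<open>Differentiating \<open>\<psi> (- t) (\<psi> t p) = p\<close>. It turns
    preservation of the kernel into the required equivalence, by applying \<open>ker\<close> to time
    \<open>- t\<close>.\<close>
  have V_inv: "V (- t) (\<psi> t p) (V t p v) = v" for t p v
  proof -
    have "((\<lambda>p. \<psi> (- t) (\<psi> t p)) has_derivative (\<lambda>v. V (- t) (\<psi> t p) (V t p v))) (at p)"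
      by (rule has_derivative_compose[OF V V])
    then have "((\<lambda>p. p) has_derivative (\<lambda>v. V (- t) (\<psi> t p) (V t p v))) (at p)"
      by (simp add: group \<psi>0)
    from has_derivative_unique[OF this has_derivative_ident] show ?thesis by (rule fun_cong)
  qed
  have contact: "contactomorphism (\<phi> t)" for t
    unfolding contactomorphism_def
  proof (intro conjI allI)
    define \<eta> where "\<eta> q = \<psi> (- t) (stretch (b * t) q)" for q
    have inv: "\<phi> t (\<eta> q) = q" "\<eta> (\<phi> t q) = q" for q
      using stretch_inverse[of "b * t"] by (simp_all add: \<phi>_def \<eta>_def group \<psi>0)
    then have "bij (\<phi> t)" by (metis bijI')
    moreover have "inv \<phi>t = \<eta>" if "\<phi>t = \<phi> t" for \<phi>t
      unfolding that using inv by (intro inv_equality) auto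
    moreover have "Ck_on k UNIV (\<phi> t)" for k
      unfolding \<phi>_def[abs_def] by (intro Ck_stretch Ck_const C\<psi>t)
    moreover have "Ck_on k UNIV \<eta>" for k
      unfolding \<eta>_def[abs_def] by (intro Ck_compose[OF C\<psi>t] Ck_stretch Ck_const Ck_ident)
    ultimately show "diffeomorphism UNIV UNIV (\<phi> t)"
      by (auto simp: diffeomorphism_def smooth_on_def)
    fix p v
    have "(\<phi> t has_derivative (\<lambda>v. stretch (- (b * t)) (V t p v))) (at p)"
      unfolding \<phi>_def[abs_def] by (rule bounded_linear.has_derivative[OF bounded_linear_stretch V])
    then have "frechet_derivative (\<phi> t) (at p) = (\<lambda>v. stretch (- (b * t)) (V t p v))"
      using frechet_derivative_at by metis
    then have "alpha_std (\<phi> t p) (frechet_derivative (\<phi> t) (at p) v) = 0 \<longleftrightarrow>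
        alpha_std (\<psi> t p) (V t p v) = 0"
      by (simp add: \<phi>_def alpha_std_stretch)
    also have "\<dots> \<longleftrightarrow> alpha_std p v = 0"
      using ker[of p v t] ker[of "\<psi> t p" "V t p v" "- t"] by (auto simp: V_inv group \<psi>0)
    finally show "alpha_std (\<phi> t p) (frechet_derivative (\<phi> t) (at p) v) = 0 \<longleftrightarrow> alpha_std p v = 0" .
  qed
  have "Ck_on k UNIV (\<lambda>(t, p). \<phi> t p)" for k
    unfolding \<phi>_def case_prod_unfold
    by (intro Ck_stretch C\<psi>[unfolded case_prod_unfold] Ck_uminus Ck_mult Ck_const Ck_fst Ck_ident)
  then have "smooth_on ({0..1} \<times> UNIV) (\<lambda>(t, p). \<phi> t p)" by (rule smooth_on_unit_time)
  then have "contact_isotopy \<phi>"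
    using contact by (simp add: contact_isotopy_def \<phi>_def \<psi>0)
  then show thesis using that[OF \<psi>0 \<psi>] by (simp add: \<phi>_def[abs_def])
qed

section \<open>Reeb chords and displacement\<close>

lemma reeb_chord_fst:
  assumes "reeb_chord A B l \<gamma>"
  shows "fst (\<gamma> 0) = fst (\<gamma> l)"
proof -
  have l: "0 \<le> l" and d: "\<And>t. t \<in> {0..l} \<Longrightarrow> (\<gamma> has_vector_derivative reeb_field (\<gamma> t)) (at t within {0..l})"
    using assms by (auto simp: reeb_chord_def)
  have "((\<lambda>t. fst (\<gamma> t)) has_vector_derivative 0) (at t within {0..l})" if "t \<in> {0..l}" for t
    using bounded_linear.has_vector_derivative[OF bounded_linear_fst d[OF that]] by (simp add: reeb_field_def)
  then obtain c where "\<And>t. t \<in> {0..l} \<Longrightarrow> fst (\<gamma> t) = c"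
    using has_vector_derivative_zero_constant[of "{0..l}" "\<lambda>t. fst (\<gamma> t)"] by auto
  then show ?thesis using l by simp
qed

lemma not_reeb_chord_if_shifted:
  assumes A: "\<And>p. p \<in> A \<Longrightarrow> norm p \<le> R" and B: "\<And>q. q \<in> B \<Longrightarrow> \<exists>p\<in>A. fst q = fst p + v"
    and v: "2 * R < norm v"
  shows "\<not> reeb_chord A B l \<gamma>" "\<not> reeb_chord B A l \<gamma>"
proof -
  have "fst p \<noteq> fst q" if pq: "p \<in> A" "q \<in> B" for p q
  proof
    assume eq: "fst p = fst q"
    obtain p' where p': "p' \<in> A" "fst q = fst p' + v" using B[OF pq(2)] by blast
    have R: "norm (fst x) \<le> R" if "x \<in> A" for x
      using A[OF that] norm_fst_le[of "fst x" "snd x"] by simp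
    have "v = fst p - fst p'" using eq p' by simp
    then have "norm v \<le> norm (fst p) + norm (fst p')" by (simp add: norm_triangle_ineq4)
    then show False using R[OF pq(1)] R[OF p'(1)] v by simp
  qed
  then show "\<not> reeb_chord A B l \<gamma>" "\<not> reeb_chord B A l \<gamma>"
    using reeb_chord_fst unfolding reeb_chord_def by metis+
qed

lemma displacing_hamiltonian_exists:
  fixes \<Lambda> :: "'n::finite jet set"
  assumes \<Lambda>: "compact \<Lambda>" "\<Lambda> \<subseteq> slab a" and a: "0 < a" and \<epsilon>: "0 < \<epsilon>"
  obtains H where "contact_hamiltonian H" "compactly_supported H" "osc_norm H = a + \<epsilon>" "displaces H \<Lambda>"
proof -
  obtain R where R: "R > 0" "\<And>p. p \<in> \<Lambda> \<Longrightarrow> norm p \<le> R"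
    using compact_imp_bounded[OF \<Lambda>(1)] unfolding bounded_pos by blast
  obtain e :: "real ^ 'n" where "e \<in> Basis" using nonempty_Basis by blast
  then have e: "norm e = 1" by simp
  define c where "c = 2 * R + 1"
  \<comment> \<open>This gives \<open>c * R < \<epsilon> * b / 2\<close>, so that translating by
    \<open>c\<close> uses less than \<open>\<epsilon>\<close> of the oscillation.\<close>
  define b where "b = 2 * c * R / \<epsilon> + 1"
  \<comment> \<open>The bound for \<open>l\<close> at a point with
    \<open>\<bar>z\<bar> \<le> a / 2\<close> and \<open>norm y \<le> R\<close>.\<close>
  define M where "M = b * (a / 2) + c * R"
  \<comment> \<open>The solution of
    \<open>2 * N * (1 - exp (- b)) / b = a + \<epsilon>\<close>.\<close>
  define N where "N = (a + \<epsilon>) * b / (2 * (1 - exp (- b)))"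
  have c: "c > 0" "2 * R < c" using R by (auto simp: c_def)
  have b: "b > 0" using R c \<epsilon> by (auto simp: b_def intro: add_nonneg_pos)
  have M: "0 \<le> M" using a b c R by (simp add: M_def)
  have eb: "0 < 1 - exp (- b)" "1 - exp (- b) \<le> 1" using b by auto
  have MN: "M < N"
  proof -
    have "c * R < \<epsilon> * b / 2" using \<epsilon> by (simp add: b_def field_simps)
    then have "M < (a + \<epsilon>) * b / 2" by (simp add: M_def field_simps)
    also have "\<dots> \<le> N"
      unfolding N_def using eb a \<epsilon> b by (intro divide_left_mono) auto
    finally show ?thesis .
  qed
  define l where "l p = - (b * snd (snd p) + c * (e \<bullet> fst (snd p)))" for p :: "'n jet"
  have l: "bounded_linear l"
    unfolding l_def[abs_def]
    by (intro bounded_linear_minus bounded_linear_add bounded_linear_const_mult bounded_linear_snd_comp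
        bounded_linear_fst_comp bounded_linear_inner_right_comp bounded_linear_ident)
  have "l (0, 0, 1) \<noteq> 0" using b by (simp add: l_def)
  then have l0: "l \<noteq> (\<lambda>_. 0)" by auto
  \<comment> \<open>During unit time the points of \<open>\<Lambda>\<close> are translated by at
    most \<open>c\<close>, so they stay in the ball of radius \<open>R + c\<close>.\<close>
  have Rc: "0 \<le> R + c" using R c by simp
  obtain G \<rho> where G: "\<And>k. Ck_on k UNIV G" and G0: "\<And>p. norm p > \<rho> \<Longrightarrow> G p = 0"
    and GN: "\<And>p. \<bar>G p\<bar> \<le> N" and Gmax: "\<exists>p. G p = N" and Gmin: "\<exists>p. G p = - N"
    and Gl: "\<And>p. norm p \<le> R + c \<Longrightarrow> \<bar>l p\<bar> \<le> M \<Longrightarrow> \<exists>U. open U \<and> p \<in> U \<and> (\<forall>q\<in>U. G q = l q)"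
    by (rule truncated_hamiltonian[OF l l0 M MN Rc]) blast
  define F where "F p = b * snd (snd p) + G p" for p
  have CF: "Ck_on k UNIV F" for k
    unfolding F_def[abs_def] by (intro Ck_add Ck_mult Ck_const Ck_snd Ck_ident G)
  \<comment> \<open>The contact field of \<open>b z\<close>. It is linear and agrees with the field
    of \<open>F\<close> outside the support of \<open>G\<close>; their difference is therefore
    Lipschitz, and so is the field of \<open>F\<close>.\<close>
  define Z :: "'n jet \<Rightarrow> 'n jet" where "Z p = (0, b *\<^sub>R fst (snd p), b * snd (snd p))" for p
  have Z: "bounded_linear Z"
    unfolding Z_def[abs_def]
    by (intro bounded_linear_Pair bounded_linear_zero bounded_linear_const_mult bounded_linear_const_scaleR
        bounded_linear_snd_comp bounded_linear_fst_comp bounded_linear_ident)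
  have out: "contact_field F p = Z p" if p: "norm p > \<rho>" for p
  proof -
    have "((\<lambda>p. b * snd (snd p)) has_derivative (\<lambda>v. 0 \<bullet> fst v + 0 \<bullet> fst (snd v) + b * snd (snd v))) (at p)"
      by (auto intro!: derivative_eq_intros)
    then have "(F has_derivative (\<lambda>v. 0 \<bullet> fst v + 0 \<bullet> fst (snd v) + b * snd (snd v))) (at p)"
      by (rule has_derivative_transform_within_open[of _ _ _ _ "- cball 0 \<rho>"])
         (use p G0 in \<open>auto simp: F_def\<close>)
    from contact_field_eqI[OF this] show ?thesis using G0[OF p] by (simp add: F_def Z_def)
  qed
  have "Ck_on 1 UNIV (\<lambda>p. contact_field F p - Z p)"
    by (intro Ck_diff Ck_contact_field CF Ck_linear[OF Z])
  then obtain L1 where L1: "0 \<le> L1"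
    "\<And>p q. norm ((contact_field F p - Z p) - (contact_field F q - Z q)) \<le> L1 * norm (p - q)"
    by (rule compact_support_lipschitz[where r = \<rho>]) (use out in auto)
  obtain L2 where L2: "0 < L2" "\<And>p. norm (Z p) \<le> L2 * norm p"
    using bounded_linear.pos_bounded[OF Z] by (auto simp: mult.commute)
  have lip: "norm (contact_field F p - contact_field F q) \<le> (L1 + L2) * norm (p - q)" for p q
  proof -
    have eq: "contact_field F p - contact_field F q
        = ((contact_field F p - Z p) - (contact_field F q - Z q)) + Z (p - q)"
      using linear_diff[OF bounded_linear.linear[OF Z]] by simp
    show ?thesis
      unfolding eq distrib_right by (rule norm_triangle_mono[OF L1(2) L2(2)])
  qed
  have L: "0 \<le> L1 + L2" using L1 L2 by simp
  obtain \<psi> where \<psi>0: "\<And>p. \<psi> 0 p = p"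
    and \<psi>: "\<And>t p. ((\<lambda>t. \<psi> t p) has_vector_derivative contact_field F (\<psi> t p)) (at t)"
    and iso: "contact_isotopy (\<lambda>t p. stretch (- (b * t)) (\<psi> t p))"
    using contact_isotopy_stretched_flow[OF CF lip L] by blast
  define \<phi> where "\<phi> t p = stretch (- (b * t)) (\<psi> t p)" for t p
  define H where "H t p = exp (- (b * t)) * G (stretch (b * t) p)" for t p
  have shift: "\<psi> 1 p = p + c *\<^sub>R (e, 0, 0)" if p: "p \<in> \<Lambda>" for p
  proof -
    \<comment> \<open>The straight line solves the equation itself, so uniqueness identifies it with
      the trajectory. Since \<open>l\<close> depends only on \<open>y\<close> and \<open>z\<close>,
      which are constant on the line, bounds at \<open>p\<close> suffice.\<close>
    define \<gamma> where "\<gamma> s = p + (s * c) *\<^sub>R (e, 0, 0)" for s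
    have field: "contact_field F (\<gamma> s) = c *\<^sub>R (e, 0, 0)" if s: "0 \<le> s" "s \<le> 1" for s
    proof -
      have "norm (\<gamma> s) \<le> norm p + norm ((s * c) *\<^sub>R (e, 0 :: real ^ 'n, 0 :: real))"
        unfolding \<gamma>_def by (rule norm_triangle_ineq)
      also have "norm ((s * c) *\<^sub>R (e, 0 :: real ^ 'n, 0 :: real)) = s * c"
        using s c e by (simp add: norm_Pair abs_mult)
      also have "norm p + s * c \<le> R + c"
        using R(2)[OF p] s c by (intro add_mono mult_left_le_one_le) auto
      finally have n: "norm (\<gamma> s) \<le> R + c" .
      have ny: "norm (fst (snd p)) \<le> R"
        using R(2)[OF p] norm_snd_le[of "snd p" "fst p"] norm_fst_le[of "fst (snd p)" "snd (snd p)"] by simp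
      have "\<bar>snd (snd p)\<bar> \<le> a / 2" using \<Lambda>(2) p by (auto simp: slab_def)
      then have "\<bar>b * snd (snd p)\<bar> \<le> b * (a / 2)" using b by (simp add: abs_mult)
      moreover have "\<bar>e \<bullet> fst (snd p)\<bar> \<le> R"
        using Cauchy_Schwarz_ineq2[of e "fst (snd p)"] ny e by simp
      then have "\<bar>c * (e \<bullet> fst (snd p))\<bar> \<le> c * R" using c by (simp add: abs_mult)
      ultimately have "\<bar>l (\<gamma> s)\<bar> \<le> M" by (simp add: l_def \<gamma>_def M_def)
      from Gl[OF n this] obtain U where U: "open U" "\<gamma> s \<in> U" "\<And>q. q \<in> U \<Longrightarrow> G q = l q" by blast
      \<comment> \<open>Near the line \<open>b z\<close> cancels and \<open>F\<close> is linear in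
        \<open>y\<close>. Homogeneity of degree one then makes the z component
        \<open>F - y . grad_y F\<close> vanish.\<close>
      have "((\<lambda>q. - (c * (e \<bullet> fst (snd q)))) has_derivative
          (\<lambda>v. 0 \<bullet> fst v + (- c *\<^sub>R e) \<bullet> fst (snd v) + 0 * snd (snd v))) (at (\<gamma> s))"
        by (auto intro!: derivative_eq_intros)
      then have "(F has_derivative (\<lambda>v. 0 \<bullet> fst v + (- c *\<^sub>R e) \<bullet> fst (snd v) + 0 * snd (snd v))) (at (\<gamma> s))"
        by (rule has_derivative_transform_within_open[OF _ U(1,2)]) (simp add: F_def U(3) l_def)
      from contact_field_eqI[OF this] show ?thesis
        using U by (simp add: F_def l_def inner_commute zero_prod_def)
    qed
    have d: "((\<lambda>s. \<psi> s p - \<gamma> s) has_vector_derivative contact_field F (\<psi> s p) - contact_field F (\<gamma> s)) (at s)"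
      if "0 \<le> s" "s \<le> 1" for s
      unfolding field[OF that]
      by (intro has_vector_derivative_diff \<psi>) (auto simp: \<gamma>_def zero_prod_def intro!: derivative_eq_intros)
    have "norm (\<psi> 1 p - \<gamma> 1) \<le> (norm (\<psi> 0 p - \<gamma> 0) + 0 * 1) * exp ((L1 + L2) * 1)"
      by (rule gronwall_nonneg[OF _ d]) (use lip L in auto)
    then show ?thesis by (simp add: \<psi>0 \<gamma>_def)
  qed
  have gen: "generates H \<phi>"
    unfolding generates_def
  proof (intro conjI ballI allI)
    show "contact_isotopy \<phi>" using iso by (simp add: \<phi>_def[abs_def])
    fix t :: real and p assume t: "t \<in> {0..1}"
    have "((\<lambda>s. \<phi> s p) has_vector_derivative
        stretch (- (b * t)) (contact_field F (\<psi> t p) - Z (\<psi> t p))) (at t)"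
    proof -
      \<comment> \<open>Differentiating the factor \<open>exp (- (b * s))\<close> contributes
        \<open>- Z\<close>. The form takes the value \<open>b z\<close> on \<open>Z\<close>, which
        removes this term from \<open>F\<close> and leaves \<open>G\<close>.\<close>
      have E: "((\<lambda>s. exp (- (b * s))) has_real_derivative - b * exp (- (b * t))) (at t)"
        by (auto intro!: derivative_eq_intros)
      note y = bounded_linear.has_vector_derivative[OF bounded_linear_fst
          bounded_linear.has_vector_derivative[OF bounded_linear_snd \<psi>[of p t]]]
      note z = bounded_linear.has_vector_derivative[OF bounded_linear_snd
          bounded_linear.has_vector_derivative[OF bounded_linear_snd \<psi>[of p t]]]
      show ?thesis
        unfolding \<phi>_def stretch_def
        by (rule has_vector_derivative_eq_rhs,
            rule has_vector_derivative_Pair[OF bounded_linear.has_vector_derivative[OF bounded_linear_fst \<psi>]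
              has_vector_derivative_Pair[OF has_vector_derivative_scaleR[OF E y]
                has_vector_derivative_mult[OF E[unfolded has_real_derivative_iff_has_vector_derivative] z]]])
           (simp add: Z_def algebra_simps)
    qed
    then have "vector_derivative (\<lambda>s. \<phi> s p) (at t within {0..1}) =
        stretch (- (b * t)) (contact_field F (\<psi> t p) - Z (\<psi> t p))"
      using t by (intro vector_derivative_at_within_ivl) auto
    moreover have "alpha_std q (contact_field F q - Z q) = G q" for q
      using alpha_std_contact_field[of q F] by (simp add: alpha_std_eq Z_def F_def)
    ultimately show "H t (\<phi> t p) =
        alpha_std (\<phi> t p) (vector_derivative (\<lambda>s. \<phi> s p) (at t within {0..1}))"
      by (simp add: \<phi>_def H_def alpha_std_stretch)
  qed
  have ham: "contact_hamiltonian H"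
    unfolding contact_hamiltonian_def H_def case_prod_unfold
    by (intro smooth_on_unit_time Ck_mult Ck_compose[OF Ck_exp] Ck_compose[OF G] Ck_stretch Ck_uminus
        Ck_const Ck_fst Ck_snd Ck_ident)
  have supp: "compactly_supported H"
    unfolding compactly_supported_def
  proof (intro exI[of _ "cball 0 \<rho>"] conjI ballI allI impI)
    fix t :: real and p :: "'n jet" assume t: "t \<in> {0..1}" and p: "p \<notin> cball 0 \<rho>"
    \<comment> \<open>For \<open>t \<ge> 0\<close> stretching does not decrease norms, so one ball
      contains the supports at all times.\<close>
    have "norm (stretch (- (b * t)) (stretch (b * t) p)) \<le> norm (stretch (b * t) p)"
      by (rule norm_stretch_le) (use b t in simp)
    then have "norm (stretch (b * t) p) > \<rho>" using p by simp
    then show "H t p = 0" by (simp add: H_def G0)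
  qed simp
  have "(SUP p. H t p) - (INF p. H t p) = 2 * N * exp (- (b * t))" for t
  proof -
    obtain p1 p2 where p: "G p1 = N" "G p2 = - N" using Gmax Gmin by blast
    have "(SUP p. H t p) = exp (- (b * t)) * N"
    proof (rule cSup_eq_maximum)
      show "exp (- (b * t)) * N \<in> range (H t)"
        by (rule image_eqI[of _ _ "stretch (- (b * t)) p1"])
           (use p stretch_inverse(1)[of "b * t" p1] in \<open>simp_all add: H_def\<close>)
      fix x assume "x \<in> range (H t)"
      then obtain p where "x = H t p" by blast
      moreover have "G (stretch (b * t) p) \<le> N" using GN[of "stretch (b * t) p"] by (simp add: abs_le_iff)
      ultimately show "x \<le> exp (- (b * t)) * N" unfolding H_def by (simp only: mult_left_mono exp_ge_zero)
    qed
    moreover have "(INF p. H t p) = exp (- (b * t)) * - N"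
    proof (rule cInf_eq_minimum)
      show "exp (- (b * t)) * - N \<in> range (H t)"
        by (rule image_eqI[of _ _ "stretch (- (b * t)) p2"])
           (use p stretch_inverse(1)[of "b * t" p2] in \<open>simp_all add: H_def\<close>)
      fix x assume "x \<in> range (H t)"
      then obtain p where "x = H t p" by blast
      moreover have "- N \<le> G (stretch (b * t) p)" using GN[of "stretch (b * t) p"] by (simp add: abs_le_iff)
      ultimately show "exp (- (b * t)) * - N \<le> x" unfolding H_def by (simp only: mult_left_mono exp_ge_zero)
    qed
    ultimately show ?thesis by simp
  qed
  then have "osc_norm H = integral {0..1} (\<lambda>t. 2 * N * exp (- (b * t)))"
    by (simp add: osc_norm_def)
  also have "\<dots> = - (2 * N / b) * exp (- (b * 1)) - - (2 * N / b) * exp (- (b * 0))"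
  proof (rule integral_unique, rule fundamental_theorem_of_calculus)
    show "((\<lambda>t. - (2 * N / b) * exp (- (b * t))) has_vector_derivative 2 * N * exp (- (b * t)))
        (at t within {0..1})" for t
      using b unfolding has_real_derivative_iff_has_vector_derivative[symmetric]
      by (auto intro!: derivative_eq_intros)
  qed simp
  also have "\<dots> = 2 * N * (1 - exp (- b)) / b" using b by (simp add: field_simps)
  also have "\<dots> = a + \<epsilon>"
  proof -
    \<comment> \<open>Stated for a general \<open>d\<close> in place of
      \<open>1 - exp (- b)\<close>, so that the cancellation is plain field arithmetic.\<close>
    have "2 * ((a + \<epsilon>) * b / (2 * d)) * d / b = a + \<epsilon>" if "d > 0" for d using that b by simp
    from this[OF eb(1)] show ?thesis unfolding N_def .
  qed
  finally have osc: "osc_norm H = a + \<epsilon>" .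
  \<comment> \<open>Undoing the stretch at time 1 does not touch \<open>x\<close>, so the
    translation by \<open>c *\<^sub>R e\<close> survives in the original coordinates.\<close>
  have "\<exists>p\<in>\<Lambda>. fst q = fst p + c *\<^sub>R e" if "q \<in> \<phi> 1 ` \<Lambda>" for q
  proof -
    obtain p where p: "p \<in> \<Lambda>" "q = \<phi> 1 p" using \<open>q \<in> \<phi> 1 ` \<Lambda>\<close> by blast
    then show ?thesis using shift[OF p(1)] by (intro bexI[of _ p]) (simp_all add: \<phi>_def stretch_def)
  qed
  from not_reeb_chord_if_shifted[OF R(2) this] have "displaces H \<Lambda>"
    unfolding displaces_def using ham gen e c by auto
  then show thesis using that ham supp osc by blast
qed

theorem lemma1p6:
  fixes a :: real
  assumes "a > 0"
  shows "(\<forall>(\<Lambda> :: 'n::finite jet set) \<epsilon>.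
            closed_legendrian \<Lambda> \<and> \<Lambda> \<subseteq> slab a \<and> \<epsilon> > 0 \<longrightarrow>
            (\<exists>H. contact_hamiltonian H \<and> compactly_supported H \<and>
                 osc_norm H = a + \<epsilon> \<and> displaces H \<Lambda>)) \<and>
         (\<forall>\<Lambda> :: 'n jet set. standard_legendrian_sphere a \<Lambda> \<longrightarrow>
            (\<forall>c > a. \<not> (\<forall>H. contact_hamiltonian H \<and> compactly_supported H \<and> displaces H \<Lambda> \<longrightarrow>
                             c \<le> osc_norm H)))"
    (is "?upper \<and> ?sharp")
proof
  show upper: ?upper
  proof (intro allI impI)
    fix \<Lambda> :: "'n jet set" and \<epsilon> :: real
    assume "closed_legendrian \<Lambda> \<and> \<Lambda> \<subseteq> slab a \<and> \<epsilon> > 0"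
    then show "\<exists>H. contact_hamiltonian H \<and> compactly_supported H \<and> osc_norm H = a + \<epsilon> \<and> displaces H \<Lambda>"
      using displacing_hamiltonian_exists[of \<Lambda> a \<epsilon>] assms by (metis closed_legendrian_def)
  qed
  show ?sharp
  proof (intro allI impI notI)
    fix \<Lambda> :: "'n jet set" and c :: real
    assume \<Lambda>: "standard_legendrian_sphere a \<Lambda>" and c: "a < c"
      and bound: "\<forall>H. contact_hamiltonian H \<and> compactly_supported H \<and> displaces H \<Lambda> \<longrightarrow> c \<le> osc_norm H"
    have "closed_legendrian \<Lambda>" "\<Lambda> \<subseteq> slab a"
      using \<Lambda> by (auto simp: standard_legendrian_sphere_def legendrian_sphere_def)
    \<comment> \<open>Taking half the gap as \<open>\<epsilon>\<close> gives a displacing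
      Hamiltonian whose norm is still below \<open>c\<close>.\<close>
    moreover have "(c - a) / 2 > 0" using c by simp
    ultimately obtain H where "contact_hamiltonian H" "compactly_supported H" "displaces H \<Lambda>"
        "osc_norm H = a + (c - a) / 2"
      using upper by blast
    then have "c \<le> a + (c - a) / 2" using bound by metis
    then show False using c by (simp add: field_simps)
  qed
qed

end
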